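(* Let $(g,L,U)$ be payoff processes and $\{\mathcal P(t,\omega)\}_{(t,\omega)\in[0,T]\times\Omega}$ a probability class such that the following properties (all defined in the context) hold: payoff regularity, integrability, adaptedness, stability under conditioning, weak stability under pasting, path-continuity of values, and the uniform oscillation bound with functions $\{\rho_\alpha\}_{\alpha>0}$. Let $n\in\mathbb N$, $t\in[0,T]$ and $\alpha>0$. Then for any $\omega\in O^t_\alpha(\mathbf 0)$ (i.e. $\omega\in\Omega$ with $\|\omega\|_{0,t}<\alpha$), $$\overline V_t(\omega)\le V^n_t(\omega)+\rho_\alpha(2^{-n})+2^{-n}\big(|g_t(\omega)|+\rho_\alpha(T-t)\big).$$
   Context: **Canonical spaces.** Fix $d\in\mathbb N$, $T\in(0,\infty)$. A modulus of continuity function is a nondecreasing $\rho:[0,\infty)\to[0,\infty)$ with $\rho(0)=\lim_{x\downarrow0}\rho(x)=0$. For $t\in[0,T]$ let $\Omega^t=\{\omega\in C([t,T];\mathbb R^d):\omega(t)=0\}$, $\|\omega\|_{t,s}=\sup_{r\in[t,s]}|\omega(r)|$, $B^t$ the canonical process on $\Omega^t$, $\mathcal F^t_s=\sigma(B^t_r:r\in[t,s])$, $\mathbf F^t=\{\mathcal F^t_s\}_{s\in[t,T]}$ (raw filtration), $\mathcal T^t$ the set of all $\mathbf F^t$-stopping times (with values in $[t,T]$), $\mathcal T^t_s=\{\tau\in\mathcal T^t:\tau\ge s \text{ everywhere}\}$, and $\mathfrak P_t$ the set of all probabilities on $(\Omega^t,\mathcal F^t_T)$. For $n\in\mathbb N$,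 $\mathcal T^t(n)$ is the set of $\tau\in\mathcal T^t$ with values in $\{t\vee(i2^{-n}T)\}_{i=0}^{2^n}$, and $\mathcal T^t_s(n)=\mathcal T^t(n)\cap\mathcal T^t_s$; put $\mathcal T^t(\infty)=\mathcal T^t$, $\mathcal T^t_s(\infty)=\mathcal T^t_s$. The superscript $t$ is dropped when $t=0$; $\mathbf 0\in\Omega$ is the null path. For $\omega\in\Omega^t$, $\delta>0$: $O^s_\delta(\omega)=\{\omega'\in\Omega^t:\|\omega'-\omega\|_{t,s}<\delta\}$. $\mathbb S(\mathbf F^t,\mathbb P)$ is the set of real-valued $\mathbf F^t$-adapted processes $X$ on $[t,T]$ with all paths continuous and $\mathbb E_{\mathbb P}[\sup_{s\in[t,T]}|X_s|]<\infty$. **Shifts.** For $t\le s$, $\omega\in\Omega^t$, $\tilde\omega\in\Omega^s$: $(\omega\otimes_s\tilde\omega)(r)=\omega(r)\mathbf 1_{\{r<s\}}+(\omega(s)+\tilde\omega(r))\mathbf 1_{\{r\ge s\}}$, $r\in[t,T]$. For a random variable $\xi$ (resp. process $X$) on $\Omega^t$: $\xi^{s,\omega}(\tilde\omega)=\xi(\omega\otimes_s\tilde\omega)$, $X^{s,\omega}_r(\tilde\omega)=X_r(\omega\otimes_s\tilde\omega)$, $r\in[s,T]$. For $\mathbb P\in\mathfrak P_t$, $\mathbb P^{s,\omega}\in\mathfrak P_s$ is defined by $\mathbb P^{s,\omega}(A)=\mathbb P^\omega_s(\omega\otimes_sA)$, $A\in\mathcal F^s_T$, where $\{\mathbb P^\omega_s\}_{\omega\in\Omega^t}$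 is the regular conditional probability distribution of $\mathbb P$ given $\mathcal F^t_s$ with $\mathbb P^\omega_s(\omega\otimes_s\Omega^s)=1$ for all $\omega$. **Payoff regularity.** $g,L,U$ are real-valued processes on $[0,T]\times\Omega$ with $L\le U$ everywhere, and there is a modulus of continuity function $\rho_0$ such that each $X\in\{g,L,U\}$ satisfies $|X_{t_1}(\omega_1)-X_{t_2}(\omega_2)|\le\rho_0\big(|t_1-t_2|+\|\omega_1(\cdot\wedge t_1)-\omega_2(\cdot\wedge t_2)\|_{0,T}\big)$ for all $(t_i,\omega_i)\in[0,T]\times\Omega$. Put $\Psi_t=(-L_t)\vee U_t\vee0$ and, for $\tau,\gamma\in\mathcal T^t$, $R^{t,\omega}(\tau,\gamma)=\int_t^{\tau\wedge\gamma}g^{t,\omega}_s\,ds+\mathbf 1_{\{\tau\le\gamma\}}L^{t,\omega}_\tau+\mathbf 1_{\{\gamma<\tau\}}U^{t,\omega}_\gamma$. **Integrability.** For every $t\in[0,T]$ the set $\widehat{\mathfrak P}_t=\{\mathbb P\in\mathfrak P_t:\Psi^{t,\mathbf 0}\in\mathbb S(\mathbf F^t,\mathbb P),\ \mathbb E_{\mathbb P}\int_t^T|g^{t,\mathbf 0}_s|ds<\infty\}$ is nonempty. **Adaptedness.** For all $(t,\omega)$, $\mathcal P(t,\omega)$ is a nonempty subset of $\widehat{\mathfrak P}_t$, and $\mathcal P(t,\omega_1)=\mathcal P(t,\omega_2)$ if $\omega_1|_{[0,t]}=\omega_2|_{[0,t]}$. **Stability under conditioning.** For all $0\le t<s\le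 T$, $\omega\in\Omega$, $\mathbb P\in\mathcal P(t,\omega)$ there exist an extension $(\Omega^t,\mathcal F',\mathbb P')$ of $(\Omega^t,\mathcal F^t_T,\mathbb P)$ (i.e. $\mathcal F^t_T\subset\mathcal F'$, $\mathbb P'|_{\mathcal F^t_T}=\mathbb P$) and $\Omega'\in\mathcal F'$ with $\mathbb P'(\Omega')=1$ such that $\mathbb P^{s,\tilde\omega}\in\mathcal P(s,\omega\otimes_t\tilde\omega)$ for all $\tilde\omega\in\Omega'$. **Weak stability under pasting.** There is a modulus of continuity function $\widehat\rho_0$ such that for all $0\le t<s\le T$, $\omega\in\Omega$, $\mathbb P\in\mathcal P(t,\omega)$, $\delta\in\mathbb Q_+$ (positive rational), $\lambda\in\mathbb N$, every $\mathcal F^t_s$-measurable partition $\{\mathcal A_j\}_{j=0}^\lambda$ of $\Omega^t$ such that for $j=1,\dots,\lambda$, $\mathcal A_j\subset O^s_{\delta_j}(\tilde\omega_j)$ for some $\delta_j\in((0,\delta]\cap\mathbb Q)\cup\{\delta\}$, $\tilde\omega_j\in\Omega^t$, and all $\mathbb P_j\in\mathcal P(s,\omega\otimes_t\tilde\omega_j)$, $j=1,\dots,\lambda$, there is $\widehat{\mathbb P}\in\mathcal P(t,\omega)$ with: (i) $\widehat{\mathbb P}(A\cap\mathcal A_0)=\mathbb P(A\cap\mathcal A_0)$ for all $A\in\mathcal F^t_T$; (ii) $\widehat{\mathbb P}(A\cap\mathcal A_j)=\mathbb P(A\cap\mathcal A_j)$ for all $j=1,\dots,\lambda$, $A\in\mathcal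 F^t_s$; (iii) for any $n\in\mathbb N\cup\{\infty\}$ and $\wp\in\mathcal T^s$ there exist $\wp^n_j\in\mathcal T^t_s$, $j=1,\dots,\lambda$, such that for any $A\in\mathcal F^t_s$ and $\tau\in\mathcal T^t_s(n)$, $$\sum_{j=1}^\lambda\mathbb E_{\widehat{\mathbb P}}\big[\mathbf 1_{A\cap\mathcal A_j}R^{t,\omega}(\tau,\wp^n_j)\big]\le\sum_{j=1}^\lambda\mathbb E_{\mathbb P}\Big[\mathbf 1_{\{\tilde\omega\in A\cap\mathcal A_j\}}\Big(\sup_{\varsigma\in\mathcal T^s(n)}\mathbb E_{\mathbb P_j}\big[R^{s,\omega\otimes_t\tilde\omega}(\varsigma,\wp)\big]+\int_t^sg^{t,\omega}_r(\tilde\omega)dr\Big)\Big]+\widehat\rho_0(\delta).$$ **Values.** For $n\in\mathbb N\cup\{\infty\}$, $V^n_t(\omega)=\inf_{\mathbb P\in\mathcal P(t,\omega)}\inf_{\gamma\in\mathcal T^t}\sup_{\tau\in\mathcal T^t(n)}\mathbb E_{\mathbb P}[R^{t,\omega}(\tau,\gamma)]$, and $\overline V:=V^\infty$. **Path-continuity of values.** There is a modulus of continuity function $\rho_1\ge\rho_0$ such that $|V^n_t(\omega_1)-V^n_t(\omega_2)|\le\rho_1(\|\omega_1-\omega_2\|_{0,t})$ for all $n\in\mathbb N\cup\{\infty\}$, $t\in[0,T]$, $\omega_1,\omega_2\in\Omega$. **Uniform oscillation bound.** For every $\alpha>0$ there is a modulus of continuity function $\rho_\alpha$ such that for all $t\in[0,T)$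 and $\delta\in(0,T]$, $$\sup_{\omega\in O^t_\alpha(\mathbf 0)}\ \sup_{\mathbb P\in\mathcal P(t,\omega)}\ \sup_{\zeta\in\mathcal T^t}\mathbb E_{\mathbb P}\Big[\rho_1\Big(\delta+\sup_{r\in[\zeta,(\zeta+\delta)\wedge T]}|B^t_r-B^t_\zeta|\Big)\Big]\le\rho_\alpha(\delta),$$ with $\rho_1$ as in the path-continuity of values.
   Formalization: In the bound, both occurrences of 2^{-n} are replaced by the grid mesh 2^{-n}T; as printed the inequality fails for large T (e.g. T=16, n=3, g=0, L_t=max(0,1-|t-1|), U=L+2, Dirac class at the null path), and for T≤1 the corrected bound implies it. *)

theory Defs
  imports "HOL-Probability.Probability"
begin

definition modulus :: "(real \<Rightarrow> real) \<Rightarrow> bool" where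
  "modulus \<rho> \<longleftrightarrow>
     mono_on {0..} \<rho> \<and> (\<forall>x\<ge>0. 0 \<le> \<rho> x) \<and> \<rho> 0 = 0 \<and> (\<rho> \<longlongrightarrow> 0) (at_right 0)"

section \<open>Canonical spaces\<close>

type_synonym 'd path = "real \<Rightarrow> real^'d"

text \<open>The set of continuous paths on \<open>[t, T]\<close> starting in 0 at time \<open>t\<close>. Paths are
  extensional, so that equality in the type \<open>'d path\<close> is equality of functions on \<open>[t, T]\<close>.\<close>

definition Om :: "real \<Rightarrow> real \<Rightarrow> ('d::finite) path set" where
  "Om T t = {\<omega> \<in> extensional {t..T}. continuous_on {t..T} \<omega> \<and> \<omega> t = 0}"

definition null_path :: "real \<Rightarrow> ('d::finite) path" where
  "null_path T = restrict (\<lambda>_. 0) {0..T}"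

definition pnorm :: "real \<Rightarrow> real \<Rightarrow> ('d::finite) path \<Rightarrow> real" where
  "pnorm t s \<omega> = (SUP r\<in>{t..s}. norm (\<omega> r))"

definition pball :: "real \<Rightarrow> real \<Rightarrow> real \<Rightarrow> real \<Rightarrow> ('d::finite) path \<Rightarrow> 'd path set" where
  "pball T t s \<delta> \<omega> = {\<omega>' \<in> Om T t. pnorm t s (\<lambda>r. \<omega>' r - \<omega> r) < \<delta>}"

text \<open>The raw filtration generated by the canonical process on \<open>Om T t\<close>. The library's
  \<open>stopping_time\<close> quantifies over all real times, so the filtration is constant after \<open>T\<close> and
  trivial before \<open>t\<close>; for stopping times with values in \<open>[t, T]\<close> these times impose no
  condition.\<close>

definition Fil :: "real \<Rightarrow> real \<Rightarrow> real \<Rightarrow> ('d::finite) path measure" where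
  "Fil T t s = sigma (Om T t)
     {{\<omega> \<in> Om T t. \<omega> r \<in> A} | r A. r \<in> {t..min s T} \<and> A \<in> sets borel}"

definition Probs :: "real \<Rightarrow> real \<Rightarrow> ('d::finite) path measure set" where
  "Probs T t = {P. prob_space P \<and> sets P = sets (Fil T t T)}"

definition ST :: "real \<Rightarrow> real \<Rightarrow> (('d::finite) path \<Rightarrow> real) set" where
  "ST T t = {\<tau>. \<tau> \<in> Om T t \<rightarrow> {t..T} \<and> stopping_time (Fil T t) \<tau>}"

text \<open>For finite \<open>n\<close> the values lie in the dyadic grid \<open>t \<or> (i 2\<^sup>-\<^sup>n T)\<close>, whose mesh is
  \<open>2\<^sup>-\<^sup>n T\<close>, not \<open>2\<^sup>-\<^sup>n\<close>. The error of approximating by such stopping times is therefore measured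
  by the mesh \<open>2\<^sup>-\<^sup>n T\<close>; an error bound with \<open>2\<^sup>-\<^sup>n\<close> in place of the mesh follows if \<open>T \<le> 1\<close>
  and fails for large \<open>T\<close>.\<close>

definition STn :: "real \<Rightarrow> real \<Rightarrow> enat \<Rightarrow> (('d::finite) path \<Rightarrow> real) set" where
  "STn T t n = (case n of
       \<infinity> \<Rightarrow> ST T t
     | enat k \<Rightarrow> {\<tau> \<in> ST T t. \<forall>\<omega>\<in>Om T t. \<tau> \<omega> \<in> {max t (real i * (1/2)^k * T) | i. i \<le> 2^k}})"

definition ST_from :: "real \<Rightarrow> real \<Rightarrow> real \<Rightarrow> enat \<Rightarrow> (('d::finite) path \<Rightarrow> real) set" where
  "ST_from T t s n = {\<tau> \<in> STn T t n. \<forall>\<omega>\<in>Om T t. s \<le> \<tau> \<omega>}"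

definition class_S :: "real \<Rightarrow> real \<Rightarrow> ('d::finite) path measure \<Rightarrow> (real \<Rightarrow> 'd path \<Rightarrow> real) set" where
  "class_S T t P = {X.
     (\<forall>s\<in>{t..T}. X s \<in> borel_measurable (Fil T t s)) \<and>
     (\<forall>\<omega>\<in>Om T t. continuous_on {t..T} (\<lambda>s. X s \<omega>)) \<and>
     (\<integral>\<^sup>+\<omega>. (SUP s\<in>{t..T}. ennreal \<bar>X s \<omega>\<bar>) \<partial>P) < \<infinity>}"

section \<open>Shifts\<close>

definition concat_at :: "real \<Rightarrow> real \<Rightarrow> real \<Rightarrow> ('d::finite) path \<Rightarrow> 'd path \<Rightarrow> 'd path" where
  "concat_at T t s \<omega> w = restrict (\<lambda>r. if r < s then \<omega> r else \<omega> s + w r) {t..T}"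

definition shift :: "real \<Rightarrow> real \<Rightarrow> (real \<Rightarrow> ('d::finite) path \<Rightarrow> real) \<Rightarrow> 'd path \<Rightarrow> real \<Rightarrow> 'd path \<Rightarrow> real" where
  "shift T t X \<omega> r w = X r (concat_at T 0 t \<omega> w)"

definition is_rcpd ::
  "real \<Rightarrow> real \<Rightarrow> real \<Rightarrow> ('d::finite) path measure \<Rightarrow> ('d path \<Rightarrow> 'd path measure) \<Rightarrow> bool" where
  "is_rcpd T t s P Q \<longleftrightarrow>
     (\<forall>\<omega>\<in>Om T t. Q \<omega> \<in> Probs T t) \<and>
     (\<forall>A\<in>sets (Fil T t T).
        (\<lambda>\<omega>. emeasure (Q \<omega>) A) \<in> borel_measurable (Fil T t s) \<and>
        (\<forall>D\<in>sets (Fil T t s). emeasure P (A \<inter> D) = (\<integral>\<^sup>+\<omega>\<in>D. emeasure (Q \<omega>) A \<partial>P))) \<and>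
     (\<forall>\<omega>\<in>Om T t. emeasure (Q \<omega>) (concat_at T t s \<omega> ` Om T s) = 1)"

text \<open>The regular conditional probability distribution is unique up to a \<open>P\<close>-null set of
  \<open>Fil T t s\<close>; \<open>rcpd\<close> fixes a version. Stability under conditioning does not depend on
  the version.\<close>

definition rcpd ::
  "real \<Rightarrow> real \<Rightarrow> real \<Rightarrow> ('d::finite) path measure \<Rightarrow> 'd path \<Rightarrow> 'd path measure" where
  "rcpd T t s P = (SOME Q. is_rcpd T t s P Q)"

definition shifted_prob ::
  "real \<Rightarrow> real \<Rightarrow> real \<Rightarrow> ('d::finite) path measure \<Rightarrow> 'd path \<Rightarrow> 'd path measure" where
  "shifted_prob T t s P \<omega> =
     measure_of (Om T s) (sets (Fil T s T)) (\<lambda>A. emeasure (rcpd T t s P \<omega>) (concat_at T t s \<omega> ` A))"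

section \<open>Payoffs and values\<close>

definition payoff_regular ::
  "real \<Rightarrow> (real \<Rightarrow> ('d::finite) path \<Rightarrow> real) \<Rightarrow> (real \<Rightarrow> 'd path \<Rightarrow> real) \<Rightarrow>
   (real \<Rightarrow> 'd path \<Rightarrow> real) \<Rightarrow> (real \<Rightarrow> real) \<Rightarrow> bool" where
  "payoff_regular T g L U \<rho>0 \<longleftrightarrow>
     modulus \<rho>0 \<and>
     (\<forall>t\<in>{0..T}. \<forall>\<omega>\<in>Om T 0. L t \<omega> \<le> U t \<omega>) \<and>
     (\<forall>X\<in>{g, L, U}. \<forall>t1\<in>{0..T}. \<forall>t2\<in>{0..T}. \<forall>\<omega>1\<in>Om T 0. \<forall>\<omega>2\<in>Om T 0.
        \<bar>X t1 \<omega>1 - X t2 \<omega>2\<bar> \<le> \<rho>0 (\<bar>t1 - t2\<bar> + pnorm 0 T (\<lambda>r. \<omega>1 (min r t1) - \<omega>2 (min r t2))))"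

definition Psi ::
  "(real \<Rightarrow> ('d::finite) path \<Rightarrow> real) \<Rightarrow> (real \<Rightarrow> 'd path \<Rightarrow> real) \<Rightarrow> real \<Rightarrow> 'd path \<Rightarrow> real" where
  "Psi L U t \<omega> = max (max (- L t \<omega>) (U t \<omega>)) 0"

definition payoff ::
  "real \<Rightarrow> (real \<Rightarrow> ('d::finite) path \<Rightarrow> real) \<Rightarrow> (real \<Rightarrow> 'd path \<Rightarrow> real) \<Rightarrow>
   (real \<Rightarrow> 'd path \<Rightarrow> real) \<Rightarrow> real \<Rightarrow> 'd path \<Rightarrow> ('d path \<Rightarrow> real) \<Rightarrow> ('d path \<Rightarrow> real) \<Rightarrow>
   'd path \<Rightarrow> real" where
  "payoff T g L U t \<omega> \<tau> \<gamma> w =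
     (LINT s:{t..min (\<tau> w) (\<gamma> w)}|lborel. shift T t g \<omega> s w) +
     (if \<tau> w \<le> \<gamma> w then shift T t L \<omega> (\<tau> w) w else shift T t U \<omega> (\<gamma> w) w)"

text \<open>Under payoff regularity and the integrability conditions all expectations, suprema and
  infima below are finite: \<open>\<bar>R\<bar>\<close> is dominated by \<open>\<integral>\<bar>g\<bar> + sup \<Psi>\<close>, and \<open>\<tau> = t\<close> shows that
  the infima are bounded below by \<open>L t \<omega>\<close>. Hence they are taken in the reals.\<close>

definition V ::
  "real \<Rightarrow> (real \<Rightarrow> ('d::finite) path \<Rightarrow> real) \<Rightarrow> (real \<Rightarrow> 'd path \<Rightarrow> real) \<Rightarrow>
   (real \<Rightarrow> 'd path \<Rightarrow> real) \<Rightarrow> (real \<Rightarrow> 'd path \<Rightarrow> 'd path measure set) \<Rightarrow>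
   enat \<Rightarrow> real \<Rightarrow> 'd path \<Rightarrow> real" where
  "V T g L U \<P> n t \<omega> =
     (INF P\<in>\<P> t \<omega>. INF \<gamma>\<in>ST T t. SUP \<tau>\<in>STn T t n. \<integral>w. payoff T g L U t \<omega> \<tau> \<gamma> w \<partial>P)"

section \<open>Standing assumptions on the probability class\<close>

definition Phat ::
  "real \<Rightarrow> (real \<Rightarrow> ('d::finite) path \<Rightarrow> real) \<Rightarrow> (real \<Rightarrow> 'd path \<Rightarrow> real) \<Rightarrow>
   (real \<Rightarrow> 'd path \<Rightarrow> real) \<Rightarrow> real \<Rightarrow> 'd path measure set" where
  "Phat T g L U t = {P \<in> Probs T t.
     shift T t (Psi L U) (null_path T) \<in> class_S T t P \<and>
     (\<integral>\<^sup>+w. (\<integral>\<^sup>+s\<in>{t..T}. ennreal \<bar>shift T t g (null_path T) s w\<bar> \<partial>lborel) \<partial>P) < \<infinity>}"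

definition integrability ::
  "real \<Rightarrow> (real \<Rightarrow> ('d::finite) path \<Rightarrow> real) \<Rightarrow> (real \<Rightarrow> 'd path \<Rightarrow> real) \<Rightarrow>
   (real \<Rightarrow> 'd path \<Rightarrow> real) \<Rightarrow> bool" where
  "integrability T g L U \<longleftrightarrow> (\<forall>t\<in>{0..T}. Phat T g L U t \<noteq> {})"

definition adapted_class ::
  "real \<Rightarrow> (real \<Rightarrow> ('d::finite) path \<Rightarrow> real) \<Rightarrow> (real \<Rightarrow> 'd path \<Rightarrow> real) \<Rightarrow>
   (real \<Rightarrow> 'd path \<Rightarrow> real) \<Rightarrow> (real \<Rightarrow> 'd path \<Rightarrow> 'd path measure set) \<Rightarrow> bool" where
  "adapted_class T g L U \<P> \<longleftrightarrow>
     (\<forall>t\<in>{0..T}. \<forall>\<omega>\<in>Om T 0. \<P> t \<omega> \<noteq> {} \<and> \<P> t \<omega> \<subseteq> Phat T g L U t) \<and>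
     (\<forall>t\<in>{0..T}. \<forall>\<omega>1\<in>Om T 0. \<forall>\<omega>2\<in>Om T 0.
        (\<forall>r\<in>{0..t}. \<omega>1 r = \<omega>2 r) \<longrightarrow> \<P> t \<omega>1 = \<P> t \<omega>2)"

definition stable_conditioning ::
  "real \<Rightarrow> (real \<Rightarrow> ('d::finite) path \<Rightarrow> 'd path measure set) \<Rightarrow> bool" where
  "stable_conditioning T \<P> \<longleftrightarrow>
     (\<forall>t s. 0 \<le> t \<and> t < s \<and> s \<le> T \<longrightarrow>
       (\<forall>\<omega>\<in>Om T 0. \<forall>P\<in>\<P> t \<omega>.
          \<exists>P' \<Omega>'. prob_space P' \<and> space P' = Om T t \<and> sets (Fil T t T) \<subseteq> sets P' \<and>
            (\<forall>A\<in>sets (Fil T t T). emeasure P' A = emeasure P A) \<and>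
            \<Omega>' \<in> sets P' \<and> emeasure P' \<Omega>' = 1 \<and>
            (\<forall>w\<in>\<Omega>'. shifted_prob T t s P w \<in> \<P> s (concat_at T 0 t \<omega> w))))"

text \<open>The members of the partition may be empty.\<close>

definition weakly_stable_pasting ::
  "real \<Rightarrow> (real \<Rightarrow> ('d::finite) path \<Rightarrow> real) \<Rightarrow> (real \<Rightarrow> 'd path \<Rightarrow> real) \<Rightarrow>
   (real \<Rightarrow> 'd path \<Rightarrow> real) \<Rightarrow> (real \<Rightarrow> 'd path \<Rightarrow> 'd path measure set) \<Rightarrow>
   (real \<Rightarrow> real) \<Rightarrow> bool" where
  "weakly_stable_pasting T g L U \<P> \<rho>h \<longleftrightarrow>
     modulus \<rho>h \<and>
     (\<forall>t s \<omega> P \<delta> l \<A> \<delta>s ws Ps.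
        0 \<le> t \<and> t < s \<and> s \<le> T \<and> \<omega> \<in> Om T 0 \<and> P \<in> \<P> t \<omega> \<and>
        \<delta> \<in> \<rat> \<and> 0 < \<delta> \<and> (1::nat) \<le> l \<and>
        (\<forall>j\<le>l. \<A> j \<in> sets (Fil T t s)) \<and> disjoint_family_on \<A> {..l} \<and> (\<Union>j\<le>l. \<A> j) = Om T t \<and>
        (\<forall>j\<in>{1..l}. \<delta>s j \<in> ({0<..\<delta>} \<inter> \<rat>) \<union> {\<delta>} \<and> ws j \<in> Om T t \<and>
           \<A> j \<subseteq> pball T t s (\<delta>s j) (ws j) \<and>
           Ps j \<in> \<P> s (concat_at T 0 t \<omega> (ws j)))
        \<longrightarrow>
        (\<exists>Ph\<in>\<P> t \<omega>.
           (\<forall>A\<in>sets (Fil T t T). emeasure Ph (A \<inter> \<A> 0) = emeasure P (A \<inter> \<A> 0)) \<and>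
           (\<forall>j\<in>{1..l}. \<forall>A\<in>sets (Fil T t s). emeasure Ph (A \<inter> \<A> j) = emeasure P (A \<inter> \<A> j)) \<and>
           (\<forall>n\<ge>1. \<forall>\<sigma>\<in>ST T s. \<exists>\<sigma>s. (\<forall>j\<in>{1..l}. \<sigma>s j \<in> ST_from T t s \<infinity>) \<and>
              (\<forall>A\<in>sets (Fil T t s). \<forall>\<tau>\<in>ST_from T t s n.
                 (\<Sum>j=1..l. \<integral>w. indicator (A \<inter> \<A> j) w * payoff T g L U t \<omega> \<tau> (\<sigma>s j) w \<partial>Ph)
                 \<le> (\<Sum>j=1..l. \<integral>w. indicator (A \<inter> \<A> j) w *
                        ((SUP \<zeta>\<in>STn T s n.
                            \<integral>v. payoff T g L U s (concat_at T 0 t \<omega> w) \<zeta> \<sigma> v \<partial>(Ps j)) +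
                         (LINT r:{t..s}|lborel. shift T t g \<omega> r w)) \<partial>P)
                   + \<rho>h \<delta>))))"

definition values_path_continuous ::
  "real \<Rightarrow> (real \<Rightarrow> ('d::finite) path \<Rightarrow> real) \<Rightarrow> (real \<Rightarrow> 'd path \<Rightarrow> real) \<Rightarrow>
   (real \<Rightarrow> 'd path \<Rightarrow> real) \<Rightarrow> (real \<Rightarrow> 'd path \<Rightarrow> 'd path measure set) \<Rightarrow>
   (real \<Rightarrow> real) \<Rightarrow> (real \<Rightarrow> real) \<Rightarrow> bool" where
  "values_path_continuous T g L U \<P> \<rho>0 \<rho>1 \<longleftrightarrow>
     modulus \<rho>1 \<and> (\<forall>x\<ge>0. \<rho>0 x \<le> \<rho>1 x) \<and>
     (\<forall>n\<ge>1. \<forall>t\<in>{0..T}. \<forall>\<omega>1\<in>Om T 0. \<forall>\<omega>2\<in>Om T 0.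
        \<bar>V T g L U \<P> n t \<omega>1 - V T g L U \<P> n t \<omega>2\<bar> \<le> \<rho>1 (pnorm 0 t (\<lambda>r. \<omega>1 r - \<omega>2 r)))"

definition uniform_oscillation ::
  "real \<Rightarrow> (real \<Rightarrow> ('d::finite) path \<Rightarrow> 'd path measure set) \<Rightarrow>
   (real \<Rightarrow> real) \<Rightarrow> (real \<Rightarrow> real \<Rightarrow> real) \<Rightarrow> bool" where
  "uniform_oscillation T \<P> \<rho>1 \<rho> \<longleftrightarrow>
     (\<forall>\<alpha>>0. modulus (\<rho> \<alpha>) \<and>
       (\<forall>t\<in>{0..<T}. \<forall>\<delta>\<in>{0<..T}.
          (SUP \<omega>\<in>pball T 0 t \<alpha> (null_path T). SUP P\<in>\<P> t \<omega>. SUP \<zeta>\<in>ST T t.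
             \<integral>\<^sup>+w. ennreal (\<rho>1 (\<delta> + (SUP r\<in>{\<zeta> w..min (\<zeta> w + \<delta>) T}. norm (w r - w (\<zeta> w))))) \<partial>P)
          \<le> ennreal (\<rho> \<alpha> \<delta>)))"

end

theory Submission
  imports Defs
begin

text \<open>
  Fix \<open>P\<close> and \<open>\<gamma>\<close>, and let \<open>\<tau>'\<close> be \<open>\<tau>\<close> rounded up to the grid of mesh \<open>h = 2\<^sup>-\<^sup>n T\<close>. If \<open>\<gamma> < \<tau>\<close> the
  payoff does not change. Otherwise the running payoffs differ by at most \<open>h sup \<bar>g\<bar>\<close>, and since
  \<open>L \<le> U\<close> the terminal payoff drops at most by the oscillation of \<open>L\<close> over \<open>[\<tau>, \<tau> + h]\<close>. The
  latter is controlled by the oscillation bound at \<open>\<tau>\<close>, and \<open>sup \<bar>g\<bar>\<close> by the one at the constant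
  time \<open>t\<close> with \<open>\<delta> = T - t\<close>. The payoffs are measurable because they are limits of payoffs along
  Bernstein polynomials of the path, which are continuous functions of finitely many coordinates.
\<close>

section \<open>Processes regular in time and in the stopped path\<close>

text \<open>The condition that \<open>payoff_regular\<close> puts on each of \<open>g\<close>,
  \<open>L\<close> and \<open>U\<close>, for a single process and with the modulus left open, so
  that \<open>\<rho>0\<close> can later be exchanged for \<open>\<rho>1\<close>.\<close>

definition path_regular ::
  "real \<Rightarrow> (real \<Rightarrow> ('d::finite) path \<Rightarrow> real) \<Rightarrow> (real \<Rightarrow> real) \<Rightarrow> bool" where
  "path_regular T X \<rho> \<longleftrightarrow>
     (\<forall>t1\<in>{0..T}. \<forall>t2\<in>{0..T}. \<forall>\<omega>1\<in>Om T 0. \<forall>\<omega>2\<in>Om T 0.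
        \<bar>X t1 \<omega>1 - X t2 \<omega>2\<bar> \<le> \<rho> (\<bar>t1 - t2\<bar> + pnorm 0 T (\<lambda>r. \<omega>1 (min r t1) - \<omega>2 (min r t2))))"

lemma path_regularD:
  assumes "path_regular T X \<rho>" "t1 \<in> {0..T}" "t2 \<in> {0..T}" "\<omega>1 \<in> Om T 0" "\<omega>2 \<in> Om T 0"
  shows "\<bar>X t1 \<omega>1 - X t2 \<omega>2\<bar> \<le> \<rho> (\<bar>t1 - t2\<bar> + pnorm 0 T (\<lambda>r. \<omega>1 (min r t1) - \<omega>2 (min r t2)))"
  using assms by (simp add: path_regular_def)

lemma modulus_mono: "modulus \<rho> \<Longrightarrow> 0 \<le> x \<Longrightarrow> x \<le> y \<Longrightarrow> \<rho> x \<le> \<rho> y"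
  by (rule mono_onD[of "{0..}" \<rho>]) (simp_all add: modulus_def)

lemma modulus_nonneg: "modulus \<rho> \<Longrightarrow> 0 \<le> x \<Longrightarrow> 0 \<le> \<rho> x"
  unfolding modulus_def by auto

lemma modulus_small:
  assumes "modulus \<rho>" "0 < e"
  obtains \<eta> where "0 < \<eta>" "\<And>x. 0 \<le> x \<Longrightarrow> x \<le> \<eta> \<Longrightarrow> \<rho> x < e"
proof -
  have "(\<rho> \<longlongrightarrow> 0) (at_right 0)" and 0: "\<rho> 0 = 0" using assms(1) by (auto simp: modulus_def)
  then have "eventually (\<lambda>x. \<rho> x < e) (at_right 0)"
    using assms(2) by (auto intro: order_tendstoD)
  then obtain b where b: "b > 0" "\<And>y. y > 0 \<Longrightarrow> y < b \<Longrightarrow> \<rho> y < e"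
    by (auto simp: eventually_at_right_field)
  show ?thesis
  proof (rule that[of "b/2"])
    fix x :: real assume "0 \<le> x" "x \<le> b/2"
    \<comment> \<open>The right-hand limit says nothing at 0 itself; there
      \<open>\<rho> 0 = 0\<close> is used.\<close>
    then show "\<rho> x < e" using b 0 assms(2) by (cases "x = 0") auto
  qed (use b in auto)
qed

lemma pnorm_le:
  assumes "t \<le> s" "\<And>r. t \<le> r \<Longrightarrow> r \<le> s \<Longrightarrow> norm (\<omega> r) \<le> c"
  shows "pnorm t s \<omega> \<le> c"
  unfolding pnorm_def using assms by (intro cSUP_least) auto

lemma pnorm_nonneg:
  assumes "t \<le> s" "bdd_above ((\<lambda>r. norm (\<omega> r)) ` {t..s})"
  shows "0 \<le> pnorm t s \<omega>"
  unfolding pnorm_def using assms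
  by (intro cSUP_upper2[where x = t]) auto

lemma Om_cont: "\<omega> \<in> Om T t \<Longrightarrow> continuous_on {t..T} \<omega>"
  by (simp add: Om_def)

lemma Om_start: "\<omega> \<in> Om T t \<Longrightarrow> \<omega> t = 0"
  by (simp add: Om_def)

lemma bdd_above_norm_diff_stopped:
  assumes "\<omega>1 \<in> Om T 0" "\<omega>2 \<in> Om T 0" "s1 \<in> {0..T}" "s2 \<in> {0..T}"
  shows "bdd_above ((\<lambda>r. norm (\<omega>1 (min r s1) - \<omega>2 (min r s2))) ` {0..T})"
proof -
  have "continuous_on {0..T} (\<lambda>r. norm (\<omega>1 (min r s1) - \<omega>2 (min r s2)))"
    using assms
    by (intro continuous_intros continuous_on_compose2[OF Om_cont[OF assms(1)]]
          continuous_on_compose2[OF Om_cont[OF assms(2)]]) auto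
  then have "compact ((\<lambda>r. norm (\<omega>1 (min r s1) - \<omega>2 (min r s2))) ` {0..T})"
    by (rule compact_continuous_image) auto
  then show ?thesis by (intro bounded_imp_bdd_above compact_imp_bounded)
qed

text \<open>Makes pointwise bounds on the stopped paths sufficient. A modulus is monotone on
  nonnegative arguments only, and \<open>pnorm\<close> is a real supremum, so its nonnegativity
  rests on the boundedness of the difference of the paths.\<close>

lemma path_regular_le:
  assumes reg: "path_regular T X \<rho>" and \<rho>: "modulus \<rho>"
    and s: "s1 \<in> {0..T}" "s2 \<in> {0..T}" and \<omega>: "\<omega>1 \<in> Om T 0" "\<omega>2 \<in> Om T 0"
    and c: "\<And>r. 0 \<le> r \<Longrightarrow> r \<le> T \<Longrightarrow> norm (\<omega>1 (min r s1) - \<omega>2 (min r s2)) \<le> c"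
    and \<delta>: "\<bar>s1 - s2\<bar> \<le> \<delta>"
  shows "\<bar>X s1 \<omega>1 - X s2 \<omega>2\<bar> \<le> \<rho> (\<delta> + c)"
proof -
  have T: "0 \<le> T" using s by auto
  have c': "pnorm 0 T (\<lambda>r. \<omega>1 (min r s1) - \<omega>2 (min r s2)) \<le> c" by (rule pnorm_le[OF T c])
  note path_regularD[OF reg s \<omega>]
  also have "\<rho> (\<bar>s1 - s2\<bar> + pnorm 0 T (\<lambda>r. \<omega>1 (min r s1) - \<omega>2 (min r s2))) \<le> \<rho> (\<delta> + c)"
    using pnorm_nonneg[OF T bdd_above_norm_diff_stopped[OF \<omega> s]] c' \<delta>
    by (intro modulus_mono[OF \<rho>]) auto
  finally show ?thesis .
qed

text \<open>The path is exchanged first, by uniform convergence, and the stopping level second, by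
  uniform continuity of the limit path. The filter is arbitrary because the lemma serves both
  continuity at a point and limits of sequences.\<close>

lemma path_regular_tendsto:
  assumes reg: "path_regular T X \<rho>" and \<rho>: "modulus \<rho>"
    and s: "\<And>k. s k \<in> {0..T}" "s0 \<in> {0..T}" and c: "\<And>k. c k \<in> Om T 0" "c0 \<in> Om T 0"
    and lim: "(s \<longlongrightarrow> s0) F" "uniform_limit {0..T} c c0 F"
  shows "((\<lambda>k. X (s k) (c k)) \<longlongrightarrow> X s0 c0) F"
proof (rule tendstoI)
  fix e :: real assume "0 < e"
  then obtain \<eta> where \<eta>: "0 < \<eta>" "\<And>x. 0 \<le> x \<Longrightarrow> x \<le> \<eta> \<Longrightarrow> \<rho> x < e"
    using modulus_small[OF \<rho>] by metis
  have "uniformly_continuous_on {0..T} c0"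
    using Om_cont[OF c(2)] by (intro compact_uniformly_continuous) auto
  then obtain d where d: "d > 0"
    "\<And>x y. x \<in> {0..T} \<Longrightarrow> y \<in> {0..T} \<Longrightarrow> dist y x < d \<Longrightarrow> dist (c0 y) (c0 x) < \<eta>/3"
    unfolding uniformly_continuous_on_def using \<eta>(1) by (metis divide_pos_pos zero_less_numeral)
  have "eventually (\<lambda>k. dist (s k) s0 < min d (\<eta>/3)) F"
    using lim(1) d(1) \<eta>(1) by (intro tendstoD) auto
  moreover have "eventually (\<lambda>k. \<forall>r\<in>{0..T}. dist (c k r) (c0 r) < \<eta>/3) F"
    using lim(2) \<eta>(1) by (intro uniform_limitD) auto
  ultimately show "eventually (\<lambda>k. dist (X (s k) (c k)) (X s0 c0) < e) F"
  proof eventually_elim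
    case (elim k)
    \<comment> \<open>One third of \<eta> is spent on the times and two thirds on the paths, so the
      argument of \<rho> is exactly \<eta>.\<close>
    have "\<bar>X (s k) (c k) - X s0 c0\<bar> \<le> \<rho> (\<eta>/3 + 2*\<eta>/3)"
    proof (rule path_regular_le[OF reg \<rho> s c])
      fix r :: real assume r: "0 \<le> r" "r \<le> T"
      have "dist (c k (min r (s k))) (c0 (min r (s k))) < \<eta>/3"
        using elim(2) r s(1)[of k] by auto
      moreover have "dist (c0 (min r (s k))) (c0 (min r s0)) < \<eta>/3"
        using r s(1)[of k] s(2) elim(1) by (intro d(2)) (auto simp: dist_real_def)
      ultimately have "dist (c k (min r (s k))) (c0 (min r s0)) < 2*\<eta>/3"
        using dist_triangle[of "c k (min r (s k))" "c0 (min r s0)" "c0 (min r (s k))"] by simp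
      then show "norm (c k (min r (s k)) - c0 (min r s0)) \<le> 2*\<eta>/3" by (simp add: dist_norm)
    qed (use elim(1) in \<open>auto simp: dist_real_def\<close>)
    also have "\<dots> < e" using \<eta> by (intro \<eta>(2)) auto
    finally show ?case by (simp add: dist_real_def)
  qed
qed

section \<open>Concatenated paths and oscillations of shifted processes\<close>

text \<open>As \<open>w t = 0\<close>, the two cases of \<open>concat_at\<close> merge into a sum of
  a path stopped at \<open>t\<close> and a path started at \<open>t\<close>. Continuity across
  \<open>t\<close> then needs no gluing.\<close>

lemma concat_at_eq:
  assumes "\<omega> \<in> Om T 0" "w \<in> Om T t" "0 \<le> t" "t \<le> T" "r \<in> {0..T}"
  shows "concat_at T 0 t \<omega> w r = \<omega> (min r t) + w (max r t)"
  using assms by (cases "r < t") (simp_all add: concat_at_def Om_start min_absorb1 min_absorb2 max_absorb1 max_absorb2)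

lemma concat_at_Om:
  assumes "\<omega> \<in> Om T 0" "w \<in> Om T t" "0 \<le> t" "t \<le> T"
  shows "concat_at T 0 t \<omega> w \<in> Om T 0"
proof -
  have "continuous_on {0..T} (\<lambda>r. \<omega> (min r t) + w (max r t))"
    using assms by (intro continuous_intros continuous_on_compose2[OF Om_cont[OF assms(1)]]
          continuous_on_compose2[OF Om_cont[OF assms(2)]]) auto
  then have "continuous_on {0..T} (concat_at T 0 t \<omega> w)"
    by (rule continuous_on_eq) (use concat_at_eq[OF assms] in auto)
  moreover have "concat_at T 0 t \<omega> w 0 = 0"
    using concat_at_eq[OF assms, of 0] assms by (simp add: Om_start min_absorb1 max_absorb2)
  ultimately show ?thesis by (auto simp: Om_def concat_at_def)
qed

text \<open>The innermost supremum of \<open>uniform_oscillation\<close>, as a function of the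
  starting time.\<close>

definition path_osc :: "real \<Rightarrow> real \<Rightarrow> real \<Rightarrow> ('d::finite) path \<Rightarrow> real" where
  "path_osc T \<delta> s w = (SUP r\<in>{s..min (s + \<delta>) T}. norm (w r - w s))"

lemma path_osc_upper:
  assumes "w \<in> Om T t" "t \<le> s" "s \<le> r" "r \<le> s + \<delta>" "r \<le> T"
  shows "norm (w r - w s) \<le> path_osc T \<delta> s w"
proof -
  have "continuous_on {s..min (s+\<delta>) T} (\<lambda>r. norm (w r - w s))"
    by (intro continuous_intros continuous_on_subset[OF Om_cont[OF assms(1)]]) (use assms in auto)
  then have "compact ((\<lambda>r. norm (w r - w s)) ` {s..min (s+\<delta>) T})"
    by (rule compact_continuous_image) auto
  then have "bdd_above ((\<lambda>r. norm (w r - w s)) ` {s..min (s+\<delta>) T})"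
    by (intro bounded_imp_bdd_above compact_imp_bounded)
  then show ?thesis unfolding path_osc_def using assms by (intro cSUP_upper) auto
qed

lemma path_osc_nonneg:
  assumes "w \<in> Om T t" "t \<le> s" "s \<le> T" "0 \<le> \<delta>"
  shows "0 \<le> path_osc T \<delta> s w"
  using order_trans[OF norm_ge_zero path_osc_upper[OF assms(1,2) order_refl, of \<delta>]] assms by simp

text \<open>Stopped at \<open>s1\<close> and at \<open>s2\<close>, the concatenated path agrees with
  itself up to \<open>s1\<close>. Later the contribution of \<omega> cancels and an increment of
  \<open>w\<close> after \<open>s1\<close> remains.\<close>

lemma shift_osc_le:
  assumes reg: "path_regular T X \<rho>" and \<rho>: "modulus \<rho>"
    and \<omega>: "\<omega> \<in> Om T 0" and w: "w \<in> Om T t" and t: "0 \<le> t" "t \<le> s1" "s1 \<le> s2" "s2 \<le> T" "s2 \<le> s1 + \<delta>"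
  shows "\<bar>shift T t X \<omega> s1 w - shift T t X \<omega> s2 w\<bar> \<le> \<rho> (\<delta> + path_osc T \<delta> s1 w)"
  unfolding shift_def
proof (rule path_regular_le[OF reg \<rho>])
  have tT: "t \<le> T" using t by simp
  show "concat_at T 0 t \<omega> w \<in> Om T 0" "concat_at T 0 t \<omega> w \<in> Om T 0"
    using concat_at_Om[OF \<omega> w] t by auto
  note eq = concat_at_eq[OF \<omega> w t(1) tT]
  fix r :: real assume r: "0 \<le> r" "r \<le> T"
  show "norm (concat_at T 0 t \<omega> w (min r s1) - concat_at T 0 t \<omega> w (min r s2)) \<le> path_osc T \<delta> s1 w"
  proof (cases "r \<le> s1")
    case True
    then have "min r s1 = r" "min r s2 = r" using t by auto
    then show ?thesis using path_osc_nonneg[OF w t(2), of \<delta>] t by simp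
  next
    case False
    then have "min r s1 = s1" "min r s2 \<in> {0..T}" "s1 \<in> {0..T}" "min s1 t = t" "max s1 t = s1"
      "min (min r s2) t = t" "max (min r s2) t = min r s2" using t by auto
    moreover have "norm (w s1 - w (min r s2)) \<le> path_osc T \<delta> s1 w"
      using path_osc_upper[OF w t(2), of "min r s2" \<delta>] t False by (auto simp: norm_minus_commute)
    ultimately show ?thesis using eq by simp
  qed
qed (use t in auto)

text \<open>Stopped at \<open>t\<close>, the concatenated path coincides with \<omega>, so the
  modulus is evaluated at 0.\<close>

lemma shift_start:
  assumes reg: "path_regular T X \<rho>" and \<rho>: "modulus \<rho>"
    and \<omega>: "\<omega> \<in> Om T 0" and w: "w \<in> Om T t" and t: "0 \<le> t" "t \<le> T"
  shows "shift T t X \<omega> t w = X t \<omega>"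
proof -
  have "\<bar>shift T t X \<omega> t w - X t \<omega>\<bar> \<le> \<rho> (0 + 0)"
    unfolding shift_def
  proof (rule path_regular_le[OF reg \<rho>])
    show "concat_at T 0 t \<omega> w \<in> Om T 0" using concat_at_Om[OF \<omega> w] t by auto
    fix r :: real assume "0 \<le> r" "r \<le> T"
    then show "norm (concat_at T 0 t \<omega> w (min r t) - \<omega> (min r t)) \<le> 0"
      using t Om_start[OF w] by (subst concat_at_eq[OF \<omega> w t]) (auto simp: max_def)
  qed (use t \<omega> in auto)
  also have "\<rho> (0 + 0) = 0" using \<rho> by (simp add: modulus_def)
  finally show ?thesis by simp
qed

lemma shift_continuous:
  assumes reg: "path_regular T X \<rho>" and \<rho>: "modulus \<rho>"
    and \<omega>: "\<omega> \<in> Om T 0" and w: "w \<in> Om T t" and t: "0 \<le> t" "t \<le> T"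
  shows "continuous_on {t..T} (\<lambda>s. shift T t X \<omega> s w)"
proof -
  let ?c = "concat_at T 0 t \<omega> w"
  \<comment> \<open>The time is clamped because \<open>path_regular_tendsto\<close> asks for times
    in \<open>{0..T}\<close> at every index, not just eventually.\<close>
  have "continuous_on {t..T} (\<lambda>s. X (max 0 (min T s)) ?c)"
    unfolding continuous_on_def
  proof (intro ballI path_regular_tendsto[OF reg \<rho>])
    fix s0 show "((\<lambda>s. max 0 (min T s)) \<longlongrightarrow> max 0 (min T s0)) (at s0 within {t..T})"
      by (intro tendsto_intros)
    show "uniform_limit {0..T} (\<lambda>_. ?c) ?c (at s0 within {t..T})"
      by (simp add: uniform_limit_iff)
  qed (use t concat_at_Om[OF \<omega> w] in auto)
  then show ?thesis
    by (rule continuous_on_eq) (use t in \<open>simp add: shift_def\<close>)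
qed

section \<open>The filtration and joint measurability through Bernstein polynomials\<close>

lemma space_Fil [simp]: "space (Fil T t s) = Om T t"
  unfolding Fil_def by (intro space_measure_of) auto

lemma sets_Fil_mono:
  assumes "s \<le> s'"
  shows "sets (Fil T t s) \<subseteq> sets (Fil T t s')"
proof -
  have "{t..min s T} \<subseteq> {t..min s' T}" using assms by auto
  then show ?thesis
    unfolding Fil_def by (subst (1 2) sets_measure_of) (blast intro!: sigma_sets_mono')+
qed

text \<open>Holds also for \<open>s > T\<close>, by the cutoff \<open>min s T\<close> in
  \<open>Fil\<close>. The measurability of stopping times needs it at all real times.\<close>

lemma sets_Fil_subset_top: "sets (Fil T t s) \<subseteq> sets (Fil T t T)"
  unfolding Fil_def by (subst (1 2) sets_measure_of) (auto intro!: sigma_sets_mono')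

lemma eval_measurable:
  assumes "r \<in> {t..T}"
  shows "(\<lambda>w. w r) \<in> borel_measurable (Fil T t T)"
proof (rule measurableI)
  fix A :: "(real^'d) set" assume "A \<in> sets borel"
  then have "{\<omega> \<in> Om T t. \<omega> r \<in> A} \<in> sets (Fil T t T)"
    unfolding Fil_def using assms by (intro in_measure_of) auto
  moreover have "(\<lambda>w. w r) -` A \<inter> space (Fil T t T) = {\<omega> \<in> Om T t. \<omega> r \<in> A}" by auto
  ultimately show "(\<lambda>w. w r) -` A \<inter> space (Fil T t T) \<in> sets (Fil T t T)" by simp
qed simp

text \<open>The summand \<open>k = 0\<close> is left out so that the path starts in 0 for every choice of \<open>y\<close>.\<close>

definition bernstein_path :: "real \<Rightarrow> real \<Rightarrow> nat \<Rightarrow> (nat \<Rightarrow> real^'d) \<Rightarrow> ('d::finite) path" where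
  "bernstein_path T t m y =
     restrict (\<lambda>r. \<Sum>k=1..m. Bernstein m k ((r - t) / (T - t)) *\<^sub>R y k) {t..T}"

lemma bernstein_path_Om:
  assumes "t < T"
  shows "bernstein_path T t m y \<in> Om T t"
proof -
  have "continuous_on {t..T} (\<lambda>r. \<Sum>k=1..m. Bernstein m k ((r - t) / (T - t)) *\<^sub>R y k)"
    unfolding Bernstein_def using assms by (intro continuous_intros) auto
  then have "continuous_on {t..T} (bernstein_path T t m y)"
    by (rule continuous_on_eq) (simp add: bernstein_path_def)
  moreover have "bernstein_path T t m y t = 0"
    using assms by (auto simp: bernstein_path_def Bernstein_def intro!: sum.neutral)
  ultimately show ?thesis by (simp add: Om_def bernstein_path_def)
qed

text \<open>The Bernstein polynomials of degree \<open>m\<close> are nonnegative on the unit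
  interval and sum to 1.\<close>

lemma Bernstein_le_1:
  assumes "k \<le> m" "0 \<le> x" "x \<le> 1"
  shows "Bernstein m k x \<le> 1"
  using member_le_sum[of k "{..m}" "\<lambda>k. Bernstein m k x"] Bernstein_nonneg[OF assms(2,3)] assms(1)
  by simp

text \<open>The weights lie between 0 and 1. Since the bound does not depend on \<open>r\<close>,
  the path depends continuously on its coefficients in the uniform norm.\<close>

lemma bernstein_path_diff:
  assumes "t < T" "r \<in> {t..T}"
  shows "norm (bernstein_path T t m y r - bernstein_path T t m y' r) \<le> (\<Sum>k=1..m. norm (y k - y' k))"
proof -
  have "bernstein_path T t m y r - bernstein_path T t m y' r
      = (\<Sum>k=1..m. Bernstein m k ((r - t) / (T - t)) *\<^sub>R (y k - y' k))"
    using assms by (simp add: bernstein_path_def sum_subtractf scaleR_diff_right)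
  also have "norm \<dots> \<le> (\<Sum>k=1..m. norm (y k - y' k))"
  proof (rule sum_norm_le)
    fix k assume k: "k \<in> {1..m}"
    define x where "x = (r - t) / (T - t)"
    have x: "0 \<le> x" "x \<le> 1" using assms by (auto simp: x_def field_simps)
    have "\<bar>Bernstein m k x\<bar> \<le> 1" using Bernstein_nonneg[OF x, of m k] Bernstein_le_1[OF _ x, of k m] k by simp
    then show "norm (Bernstein m k ((r - t) / (T - t)) *\<^sub>R (y k - y' k)) \<le> norm (y k - y' k)"
      unfolding x_def[symmetric] by (simp add: mult_left_le_one_le)
  qed
  finally show ?thesis .
qed

text \<open>Samples at equidistant times, extended by 0 to all indices so that they form a point of
  a countable product, where measurability is checked coordinatewise.\<close>

definition path_nodes :: "real \<Rightarrow> real \<Rightarrow> nat \<Rightarrow> ('d::finite) path \<Rightarrow> nat \<Rightarrow> real^'d" where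
  "path_nodes T t m w k = (if k \<in> {1..m} then w (t + (T - t) * (k / m)) else 0)"

lemma path_nodes_measurable:
  assumes "t < T"
  shows "path_nodes T t m \<in> borel_measurable (Fil T t T)"
proof (rule measurable_coordinatewise_then_product)
  fix k show "(\<lambda>w. path_nodes T t m w k) \<in> borel_measurable (Fil T t T)"
  proof (cases "k \<in> {1..m}")
    case True
    then have "real k / real m \<le> 1" by (simp add: field_simps)
    then have "(T - t) * (k / m) \<le> (T - t) * 1" using assms by (intro mult_left_mono) auto
    then have "t + (T - t) * (k / m) \<in> {t..T}" using assms by auto
    from eval_measurable[OF this] show ?thesis using True by (simp add: path_nodes_def)
  next
    case False
    then show ?thesis by (simp add: path_nodes_def del: atLeastAtMost_iff)
  qed
qed

text \<open>The Weierstrass theorem for each component, after rescaling time to the unit interval.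
  There are finitely many components, so one threshold serves all of them.\<close>

lemma bernstein_path_uniform_limit:
  assumes t: "t < T" and w: "w \<in> Om T t"
  shows "uniform_limit {t..T} (\<lambda>m. bernstein_path T t m (path_nodes T t m w)) w sequentially"
proof (rule uniform_limitI)
  fix e :: real assume e: "0 < e"
  define f where "f i x = w (t + (T - t) * x) $ i" for i x
  \<comment> \<open>The norm is at most the sum of the absolute values of the components, so each
    component gets an equal share of \<open>e\<close>.\<close>
  define e' where "e' = e / CARD('a)"
  have e': "e' > 0" using e by (simp add: e'_def)
  have "continuous_on {0..1} (f i)" for i
    unfolding f_def
  proof (intro continuous_intros continuous_on_compose2[OF Om_cont[OF w]])
    show "(\<lambda>x. t + (T - t) * x) ` {0..1} \<subseteq> {t..T}"
    proof safe
      fix x :: real assume "x \<in> {0..1}"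
      then have "0 \<le> (T - t) * x" "(T - t) * x \<le> T - t"
        using t mult_left_le[of x "T - t"] by simp_all
      then show "t + (T - t) * x \<in> {t..T}" unfolding atLeastAtMost_iff by linarith
    qed
  qed
  then have "\<exists>N. \<forall>n x. N \<le> n \<and> x \<in> {0..1}
      \<longrightarrow> \<bar>f i x - (\<Sum>k\<le>n. f i (k/n) * Bernstein n k x)\<bar> < e'" for i
    by (rule Bernstein_Weierstrass[OF _ e'])
  then obtain N where N: "\<And>i n x. N i \<le> n \<Longrightarrow> x \<in> {0..1}
      \<Longrightarrow> \<bar>f i x - (\<Sum>k\<le>n. f i (k/n) * Bernstein n k x)\<bar> < e'"
    by metis
  have "eventually (\<lambda>m. Max (range N) \<le> m) sequentially" by (rule eventually_ge_at_top)
  then show "\<forall>\<^sub>F m in sequentially. \<forall>r\<in>{t..T}. dist (bernstein_path T t m (path_nodes T t m w) r) (w r) < e"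
  proof eventually_elim
    case (elim m)
    show ?case
    proof
      fix r assume r: "r \<in> {t..T}"
      define x where "x = (r - t) / (T - t)"
      have x: "x \<in> {0..1}" "t + (T - t) * x = r" using t r by (auto simp: x_def field_simps)
      have "\<bar>(w r - bernstein_path T t m (path_nodes T t m w) r) $ i\<bar> < e'" for i
      proof -
        have "N i \<le> m" using elim by (meson Max_ge finite_imageI finite_class.finite_UNIV le_trans rangeI)
        \<comment> \<open>The summand \<open>k = 0\<close>, absent from
          \<open>bernstein_path\<close>, carries the factor \<open>w t = 0\<close>.\<close>
        have "(\<Sum>k\<le>m. f i (k/m) * Bernstein m k x) = (\<Sum>k=1..m. f i (k/m) * Bernstein m k x)"
          by (rule sum.mono_neutral_right) (auto simp: f_def Om_start[OF w] not_less_eq_eq)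
        also have "\<dots> = bernstein_path T t m (path_nodes T t m w) r $ i"
          using r by (simp add: bernstein_path_def path_nodes_def f_def x_def sum_component mult.commute)
        finally show ?thesis using N[OF \<open>N i \<le> m\<close> x(1)] x(2) by (simp add: f_def)
      qed
      then have "(\<Sum>i\<in>UNIV. \<bar>(w r - bernstein_path T t m (path_nodes T t m w) r) $ i\<bar>) < (\<Sum>i\<in>(UNIV::'a set). e')"
        by (intro sum_strict_mono) auto
      also have "\<dots> = e" by (simp add: e'_def)
      finally show "dist (bernstein_path T t m (path_nodes T t m w) r) (w r) < e"
        using norm_le_l1_cart[of "w r - bernstein_path T t m (path_nodes T t m w) r"]
        by (simp add: dist_norm norm_minus_commute)
    qed
  qed
qed

lemma concat_at_uniform_limit:
  assumes t: "0 \<le> t" "t \<le> T" and \<omega>: "\<omega> \<in> Om T 0" and w: "\<And>k. w k \<in> Om T t" "w0 \<in> Om T t"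
    and lim: "uniform_limit {t..T} w w0 F"
  shows "uniform_limit {0..T} (\<lambda>k. concat_at T 0 t \<omega> (w k)) (concat_at T 0 t \<omega> w0) F"
proof (rule uniform_limitI)
  fix e :: real assume "0 < e"
  from uniform_limitD[OF lim this]
  show "\<forall>\<^sub>F k in F. \<forall>r\<in>{0..T}. dist (concat_at T 0 t \<omega> (w k) r) (concat_at T 0 t \<omega> w0 r) < e"
  proof eventually_elim
    case (elim k)
    then show ?case using t
      by (simp add: concat_at_eq[OF \<omega> w(1) t] concat_at_eq[OF \<omega> w(2) t])
  qed
qed

text \<open>Each approximation is a continuous function of the time and of finitely many samples of
  the path, and these are measurable; the process is the pointwise limit. Clamping the time extends
  the process to the whole line.\<close>

lemma shift_jointly_measurable:
  assumes reg: "path_regular T X \<rho>" and \<rho>: "modulus \<rho>" and \<omega>: "\<omega> \<in> Om T 0" and t: "0 \<le> t" "t < T"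
  shows "(\<lambda>(s, w). shift T t X \<omega> (max t (min T s)) w) \<in> borel_measurable (borel \<Otimes>\<^sub>M Fil T t T)"
proof (rule borel_measurable_LIMSEQ_real)
  have tT: "t \<le> T" using t by simp
  define G where "G m p = X (max t (min T (fst p))) (concat_at T 0 t \<omega> (bernstein_path T t m (snd p)))"
    for m and p :: "real \<times> (nat \<Rightarrow> real^'a)"
  have G: "continuous_on UNIV (G m)" for m
    unfolding continuous_on_def G_def
  proof (intro ballI path_regular_tendsto[OF reg \<rho>] concat_at_uniform_limit t(1) tT \<omega> bernstein_path_Om t(2))
    fix p0 :: "real \<times> (nat \<Rightarrow> real^'a)"
    show "((\<lambda>p. max t (min T (fst p))) \<longlongrightarrow> max t (min T (fst p0))) (at p0)"
      by (intro tendsto_intros)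
    show "uniform_limit {t..T} (\<lambda>p. bernstein_path T t m (snd p)) (bernstein_path T t m (snd p0)) (at p0)"
    proof (rule uniform_limitI)
      fix e :: real assume e: "0 < e"
      \<comment> \<open>Only \<open>m\<close> coefficients enter the path, so coordinatewise
        convergence in the product topology suffices.\<close>
      have "continuous_on UNIV (\<lambda>p :: real \<times> (nat \<Rightarrow> real^'a). snd p k)" for k
        by (rule continuous_on_compose2[OF continuous_on_product_coordinates])
           (auto intro: continuous_intros)
      then have "((\<lambda>p. snd p k) \<longlongrightarrow> snd p0 k) (at p0)" for k
        unfolding continuous_on_def by blast
      then have "((\<lambda>p. \<Sum>k=1..m. norm (snd p k - snd p0 k)) \<longlongrightarrow> (\<Sum>k=1..m. norm (snd p0 k - snd p0 k))) (at p0)"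
        by (intro tendsto_intros)
      then have "eventually (\<lambda>p. (\<Sum>k=1..m. norm (snd p k - snd p0 k)) < e) (at p0)"
        using e by (intro order_tendstoD) auto
      then show "\<forall>\<^sub>F p in at p0. \<forall>r\<in>{t..T}. dist (bernstein_path T t m (snd p) r) (bernstein_path T t m (snd p0) r) < e"
        by eventually_elim (auto simp: dist_norm intro: order.strict_trans1[OF bernstein_path_diff[OF t(2)]])
    qed
  qed (use t concat_at_Om[OF \<omega> bernstein_path_Om] in auto)
  show "(\<lambda>q. G m (fst q, path_nodes T t m (snd q))) \<in> borel_measurable (borel \<Otimes>\<^sub>M Fil T t T)" for m
    using measurable_compose[OF measurable_snd path_nodes_measurable[OF t(2)]]
    by (intro measurable_compose[OF _ borel_measurable_continuous_onI[OF G]] borel_measurable_Pair) auto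
  fix q :: "real \<times> 'a path" assume "q \<in> space (borel \<Otimes>\<^sub>M Fil T t T)"
  then have q: "snd q \<in> Om T t" by (auto simp: space_pair_measure)
  show "(\<lambda>m. G m (fst q, path_nodes T t m (snd q))) \<longlonglongrightarrow> (case q of (s, w) \<Rightarrow> shift T t X \<omega> (max t (min T s)) w)"
    unfolding G_def shift_def split_beta fst_conv snd_conv using t q
    by (intro path_regular_tendsto[OF reg \<rho>] concat_at_uniform_limit bernstein_path_uniform_limit
          concat_at_Om bernstein_path_Om \<omega> tendsto_const) auto
qed

lemma shift_at_measurable:
  assumes reg: "path_regular T X \<rho>" and \<rho>: "modulus \<rho>" and \<omega>: "\<omega> \<in> Om T 0" and t: "0 \<le> t" "t < T"
    and \<sigma>: "\<sigma> \<in> borel_measurable (Fil T t T)" "\<sigma> \<in> Om T t \<rightarrow> {t..T}"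
  shows "(\<lambda>w. shift T t X \<omega> (\<sigma> w) w) \<in> borel_measurable (Fil T t T)"
proof -
  have "(\<lambda>w. (\<sigma> w, w)) \<in> Fil T t T \<rightarrow>\<^sub>M borel \<Otimes>\<^sub>M Fil T t T" using \<sigma>(1) by measurable
  from measurable_compose[OF this shift_jointly_measurable[OF reg \<rho> \<omega> t]]
  have "(\<lambda>w. shift T t X \<omega> (max t (min T (\<sigma> w))) w) \<in> borel_measurable (Fil T t T)" by simp
  also have "?this \<longleftrightarrow> ?thesis"
    using \<sigma>(2) by (intro measurable_cong) (auto simp: Pi_iff)
  finally show ?thesis .
qed

lemma shift_integral_measurable:
  assumes reg: "path_regular T X \<rho>" and \<rho>: "modulus \<rho>" and \<omega>: "\<omega> \<in> Om T 0" and t: "0 \<le> t" "t < T"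
    and \<sigma>: "\<sigma> \<in> borel_measurable (Fil T t T)" "\<sigma> \<in> Om T t \<rightarrow> {t..T}"
  shows "(\<lambda>w. LINT s:{t..\<sigma> w}|lborel. shift T t X \<omega> s w) \<in> borel_measurable (Fil T t T)"
proof -
  note [measurable] = \<sigma>(1)
  have "(\<lambda>(w, s). (s, w)) \<in> Fil T t T \<Otimes>\<^sub>M lborel \<rightarrow>\<^sub>M borel \<Otimes>\<^sub>M Fil T t T" by measurable
  from measurable_compose[OF this shift_jointly_measurable[OF reg \<rho> \<omega> t]]
  have [measurable]: "(\<lambda>(w, s). shift T t X \<omega> (max t (min T s)) w) \<in> borel_measurable (Fil T t T \<Otimes>\<^sub>M lborel)"
    by (simp add: split_beta)
  \<comment> \<open>The domain of integration depends on \<open>w\<close>; moving it into the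
    integrand leaves an integral over the line of a jointly measurable function.\<close>
  have "(\<lambda>w. LINT s|lborel. (if t \<le> s \<and> s \<le> \<sigma> w then shift T t X \<omega> (max t (min T s)) w else 0))
      \<in> borel_measurable (Fil T t T)"
    by (intro lborel.borel_measurable_lebesgue_integral) measurable
  also have "?this \<longleftrightarrow> ?thesis"
    unfolding set_lebesgue_integral_def
    using \<sigma>(2) by (intro measurable_cong Bochner_Integration.integral_cong) (auto simp: Pi_iff indicator_def)
  finally show ?thesis .
qed

section \<open>Stopping times and rounding up to the dyadic grid\<close>

lemma ST_range: "\<tau> \<in> ST T t \<Longrightarrow> w \<in> Om T t \<Longrightarrow> t \<le> \<tau> w \<and> \<tau> w \<le> T"
  by (auto simp: ST_def Pi_iff)

lemma ST_measurable:
  assumes "\<tau> \<in> ST T t"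
  shows "\<tau> \<in> borel_measurable (Fil T t T)"
  using assms by (intro measurable_stopping_time[where F = "Fil T t"] sets_Fil_subset_top) (auto simp: ST_def)

lemma const_ST: "t \<le> c \<Longrightarrow> c \<le> T \<Longrightarrow> (\<lambda>_. c) \<in> ST T t"
  by (simp add: ST_def stopping_time_const)

lemma STn_subset_ST: "STn T t n \<subseteq> ST T t"
  by (auto simp: STn_def split: enat.splits)

definition grid_ceiling :: "real \<Rightarrow> ('a \<Rightarrow> real) \<Rightarrow> 'a \<Rightarrow> real" where
  "grid_ceiling h \<tau> w = of_int \<lceil>\<tau> w / h\<rceil> * h"

lemma grid_ceiling_ge: "0 < h \<Longrightarrow> \<tau> w \<le> grid_ceiling h \<tau> w"
  unfolding grid_ceiling_def by (simp add: pos_divide_le_eq[symmetric])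

lemma grid_ceiling_le:
  assumes "0 < h"
  shows "grid_ceiling h \<tau> w \<le> \<tau> w + h"
proof -
  have "of_int \<lceil>\<tau> w / h\<rceil> * h \<le> (\<tau> w / h + 1) * h"
    using assms by (intro mult_right_mono) linarith+
  also have "\<dots> = \<tau> w + h" using assms by (simp add: field_simps)
  finally show ?thesis by (simp add: grid_ceiling_def)
qed

text \<open>This is why rounding up preserves stopping times of the raw filtration.\<close>

lemma grid_ceiling_le_iff:
  assumes "0 < h"
  shows "grid_ceiling h \<tau> w \<le> s \<longleftrightarrow> \<tau> w \<le> of_int \<lfloor>s / h\<rfloor> * h"
proof -
  have "grid_ceiling h \<tau> w \<le> s \<longleftrightarrow> of_int \<lceil>\<tau> w / h\<rceil> \<le> s / h"
    using assms by (simp add: grid_ceiling_def pos_le_divide_eq)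
  also have "\<dots> \<longleftrightarrow> \<lceil>\<tau> w / h\<rceil> \<le> \<lfloor>s / h\<rfloor>" by (simp add: le_floor_iff)
  also have "\<dots> \<longleftrightarrow> \<tau> w / h \<le> of_int \<lfloor>s / h\<rfloor>" by (simp add: ceiling_le_iff)
  finally show ?thesis using assms by (simp add: pos_divide_le_eq)
qed

text \<open>Rounding up never passes \<open>T\<close>, which is the multiple \<open>2^n * h\<close>
  of the mesh \<open>h\<close>. Since \<tau> is at least \<open>t\<close>, so is the rounded value,
  and the maximum with \<open>t\<close> in the grid changes nothing.\<close>

lemma grid_ceiling_STn:
  assumes T: "0 < T" and t: "0 \<le> t" and \<tau>: "\<tau> \<in> ST T t"
  shows "grid_ceiling ((1/2)^n * T) \<tau> \<in> STn T t (enat n)"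
proof -
  define h where "h = (1/2)^n * T"
  have h: "0 < h" "2^n * h = T" using T by (simp_all add: h_def power_divide)
  have grid: "\<exists>i\<le>2^n. grid_ceiling h \<tau> w = real i * h" if w: "w \<in> Om T t" for w
  proof (intro exI conjI)
    have "\<tau> w / h \<le> 2^n" using ST_range[OF \<tau> w] h by (simp add: pos_divide_le_eq)
    then have "\<lceil>\<tau> w / h\<rceil> \<le> 2^n" by (simp add: ceiling_le_iff)
    then show "nat \<lceil>\<tau> w / h\<rceil> \<le> 2^n" by (simp add: nat_le_iff)
    have "0 \<le> \<tau> w / h" using ST_range[OF \<tau> w] t h by simp
    then have "0 \<le> \<lceil>\<tau> w / h\<rceil>" by linarith
    then show "grid_ceiling h \<tau> w = real (nat \<lceil>\<tau> w / h\<rceil>) * h"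
      by (simp add: grid_ceiling_def)
  qed
  have range: "t \<le> grid_ceiling h \<tau> w \<and> grid_ceiling h \<tau> w \<le> T" if w: "w \<in> Om T t" for w
  proof -
    obtain i where i: "i \<le> 2^n" "grid_ceiling h \<tau> w = real i * h" using grid[OF w] by blast
    have "real i \<le> 2^n" using i(1) by (metis of_nat_le_iff of_nat_numeral of_nat_power)
    then have "real i * h \<le> 2^n * h" using h by (intro mult_right_mono) auto
    then show ?thesis using i(2) h ST_range[OF \<tau> w] grid_ceiling_ge[OF h(1), of \<tau> w] by simp
  qed
  have "stopping_time (Fil T t) (grid_ceiling h \<tau>)"
  proof
    fix s
    \<comment> \<open>This grid point may lie below \<open>t\<close>. As
      \<open>stopping_time\<close> covers all real times, no case distinction arises.\<close>
    have "of_int \<lfloor>s / h\<rfloor> * h \<le> s" using h by (simp add: pos_le_divide_eq[symmetric])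
    then have "sets (Fil T t (of_int \<lfloor>s / h\<rfloor> * h)) \<subseteq> sets (Fil T t s)" by (rule sets_Fil_mono)
    moreover have "Measurable.pred (Fil T t (of_int \<lfloor>s / h\<rfloor> * h)) (\<lambda>w. \<tau> w \<le> of_int \<lfloor>s / h\<rfloor> * h)"
      using \<tau> by (intro stopping_timeD) (simp add: ST_def)
    ultimately show "Measurable.pred (Fil T t s) (\<lambda>w. grid_ceiling h \<tau> w \<le> s)"
      unfolding grid_ceiling_le_iff[OF h(1)] by (auto simp: pred_def)
  qed
  then have "grid_ceiling h \<tau> \<in> ST T t" using range by (auto simp: ST_def)
  moreover have "grid_ceiling h \<tau> w \<in> {max t (real i * (1/2)^n * T) | i. i \<le> 2^n}" if w: "w \<in> Om T t" for w
  proof -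
    obtain i where i: "i \<le> 2^n" "grid_ceiling h \<tau> w = real i * h" using grid[OF w] by blast
    then have "grid_ceiling h \<tau> w = max t (real i * (1/2)^n * T)"
      using range[OF w] by (simp add: h_def mult.assoc max_def)
    then show ?thesis using i(1) by blast
  qed
  ultimately show ?thesis by (simp add: STn_def h_def)
qed

section \<open>Domination by functions that need not be measurable\<close>

text \<open>The dominating function \<open>Y\<close> need not be measurable. As \<open>nn_integral\<close> is additive on measurable
  functions only, the bound is applied to \<open>(\<bar>f\<bar> - c) / K \<le> Y\<close>.\<close>

lemma integrable_dominated:
  fixes f :: "'a \<Rightarrow> real"
  assumes P: "prob_space P" and f: "f \<in> borel_measurable P"
    and dom: "\<And>w. w \<in> space P \<Longrightarrow> \<bar>f w\<bar> \<le> c + K * Y w" and K: "0 < K"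
    and Y: "(\<integral>\<^sup>+w. ennreal (Y w) \<partial>P) < \<infinity>"
  shows "integrable P f"
proof -
  interpret prob_space P by (rule P)
  define h where "h = (\<lambda>w. max 0 ((\<bar>f w\<bar> - c) / K))"
  have "(\<integral>\<^sup>+w. ennreal (h w) \<partial>P) \<le> (\<integral>\<^sup>+w. ennreal (Y w) \<partial>P)"
  proof (rule nn_integral_mono)
    fix w assume "w \<in> space P"
    from dom[OF this] have "(\<bar>f w\<bar> - c) / K \<le> Y w" using K by (simp add: pos_divide_le_eq mult.commute)
    then have "ennreal ((\<bar>f w\<bar> - c) / K) \<le> ennreal (Y w)" by (rule ennreal_leI)
    then show "ennreal (h w) \<le> ennreal (Y w)" by (auto simp: h_def max_def)
  qed
  then have "(\<integral>\<^sup>+w. ennreal (h w) \<partial>P) < \<infinity>" using Y by (rule order.strict_trans1)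
  moreover have "h \<in> borel_measurable P" unfolding h_def using f by measurable
  ultimately have "integrable P h"
    by (intro integrableI_nonneg) (auto simp: h_def simp del: ennreal_max_0)
  then have "integrable P (\<lambda>w. c + K * h w)" by simp
  then show ?thesis
  proof (rule Bochner_Integration.integrable_bound[OF _ f], intro AE_I2)
    fix w
    have "(\<bar>f w\<bar> - c) / K \<le> h w" by (simp add: h_def)
    then have "\<bar>f w\<bar> \<le> c + K * h w" using K by (simp add: pos_divide_le_eq mult.commute)
    then show "norm (f w) \<le> norm (c + K * h w)" by simp
  qed
qed

text \<open>\<open>nn_integral\<close> is monotone without measurability, so it suffices to compare
  \<open>Y\<close> with the positive part of \<open>(f - c) / K\<close>, whose
  \<open>nn_integral\<close> is an ordinary integral.\<close>

lemma integral_le_dominated: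
  fixes f :: "'a \<Rightarrow> real"
  assumes P: "prob_space P" and f: "integrable P f"
    and dom: "\<And>w. w \<in> space P \<Longrightarrow> f w \<le> c + K * Y w" and K: "0 < K"
    and Y: "(\<integral>\<^sup>+w. ennreal (Y w) \<partial>P) \<le> ennreal b" and b: "0 \<le> b"
  shows "(\<integral>w. f w \<partial>P) \<le> c + K * b"
proof -
  interpret prob_space P by (rule P)
  define h where "h = (\<lambda>w. max 0 ((f w - c) / K))"
  have h: "integrable P h" unfolding h_def using f by (intro integrable_max) auto
  have "ennreal (\<integral>w. h w \<partial>P) = (\<integral>\<^sup>+w. ennreal (h w) \<partial>P)"
    using h by (intro nn_integral_eq_integral[symmetric]) (auto simp: h_def)
  also have "\<dots> \<le> (\<integral>\<^sup>+w. ennreal (Y w) \<partial>P)"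
  proof (rule nn_integral_mono)
    fix w assume "w \<in> space P"
    from dom[OF this] have "(f w - c) / K \<le> Y w" using K by (simp add: pos_divide_le_eq mult.commute)
    then have "ennreal ((f w - c) / K) \<le> ennreal (Y w)" by (rule ennreal_leI)
    then show "ennreal (h w) \<le> ennreal (Y w)" by (auto simp: h_def max_def)
  qed
  also note Y
  finally have hb: "(\<integral>w. h w \<partial>P) \<le> b" using b by simp
  have "(\<integral>w. f w \<partial>P) \<le> (\<integral>w. c + K * h w \<partial>P)"
  proof (rule integral_mono[OF f])
    fix w
    have "(f w - c) / K \<le> h w" by (simp add: h_def)
    then show "f w \<le> c + K * h w" using K by (simp add: pos_divide_le_eq mult.commute)
  qed (use h in simp)
  also have "\<dots> = c + K * (\<integral>w. h w \<partial>P)" using h by (simp add: prob_space)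
  also have "\<dots> \<le> c + K * b" using hb K by simp
  finally show ?thesis .
qed

text \<open>For passing from \<open>\<rho>0\<close> to \<open>\<rho>1\<close>, the modulus for which
  the oscillation bound is stated.\<close>

lemma path_regular_weaken:
  fixes X :: "real \<Rightarrow> ('d::finite) path \<Rightarrow> real"
  assumes reg: "path_regular T X \<rho>" and T: "0 \<le> T" and le: "\<And>x. 0 \<le> x \<Longrightarrow> \<rho> x \<le> \<rho>' x"
  shows "path_regular T X \<rho>'"
  unfolding path_regular_def
proof (intro ballI)
  fix t1 t2 and \<omega>1 \<omega>2 :: "'d path"
  assume *: "t1 \<in> {0..T}" "t2 \<in> {0..T}" "\<omega>1 \<in> Om T 0" "\<omega>2 \<in> Om T 0"
  let ?x = "\<bar>t1 - t2\<bar> + pnorm 0 T (\<lambda>r. \<omega>1 (min r t1) - \<omega>2 (min r t2))"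
  have "0 \<le> ?x" using pnorm_nonneg[OF T bdd_above_norm_diff_stopped[OF *(3,4,1,2)]] by simp
  then show "\<bar>X t1 \<omega>1 - X t2 \<omega>2\<bar> \<le> \<rho>' ?x"
    using path_regularD[OF reg *] le by (meson order_trans)
qed

section \<open>Pathwise estimates of the payoff\<close>

text \<open>The time and the past path are frozen. The horizon \<open>t = T\<close> is left out
  because the Bernstein paths rescale by \<open>T - t\<close> and the oscillation bound is assumed
  only before \<open>T\<close>.\<close>

locale game_position =
  fixes T t :: real
    and g L U :: "real \<Rightarrow> ('d::finite) path \<Rightarrow> real"
    and \<rho>1 :: "real \<Rightarrow> real"
    and \<omega> :: "'d path"
  assumes reg_g: "path_regular T g \<rho>1" and reg_L: "path_regular T L \<rho>1" and reg_U: "path_regular T U \<rho>1"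
    and \<rho>1: "modulus \<rho>1" and \<omega>: "\<omega> \<in> Om T 0" and t: "0 \<le> t" "t < T"
    and L_le_U: "\<And>s \<omega>'. s \<in> {0..T} \<Longrightarrow> \<omega>' \<in> Om T 0 \<Longrightarrow> L s \<omega>' \<le> U s \<omega>'"
begin

lemma t_le_T: "t \<le> T" using t by simp

text \<open>By the oscillation bound for the constant time \<open>t\<close> and \<open>\<delta> = T - t\<close>, the function \<open>Y\<close> has a
  finite upper integral; it dominates all three payoff processes.\<close>

definition Y :: "'d path \<Rightarrow> real" where
  "Y w = \<rho>1 (T - t + path_osc T (T - t) t w)"

lemma Y_nonneg: "w \<in> Om T t \<Longrightarrow> 0 \<le> Y w"
  unfolding Y_def using path_osc_nonneg[of w T t t "T - t"] t by (intro modulus_nonneg[OF \<rho>1]) auto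

text \<open>Comparison with time \<open>t\<close>, where the shifted process has the value
  \<open>X t \<omega>\<close>; \<open>Y\<close> measures the oscillation over all of
  \<open>{t..T}\<close>.\<close>

lemma shift_bound:
  assumes reg: "path_regular T X \<rho>1" and w: "w \<in> Om T t" and s: "t \<le> s" "s \<le> T"
  shows "\<bar>shift T t X \<omega> s w\<bar> \<le> \<bar>X t \<omega>\<bar> + Y w"
  using shift_osc_le[OF reg \<rho>1 \<omega> w t(1) order_refl s, of "T - t"] s
    shift_start[OF reg \<rho>1 \<omega> w t(1) t_le_T] unfolding Y_def by linarith

text \<open>The payoff is split into \<open>run\<close> and \<open>stop\<close>, which take numbers
  in place of stopping times, so that the estimates can be made path by path.\<close>

definition run :: "real \<Rightarrow> 'd path \<Rightarrow> real" where
  "run a w = (LINT s:{t..a}|lborel. shift T t g \<omega> s w)"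

definition stop :: "real \<Rightarrow> real \<Rightarrow> 'd path \<Rightarrow> real" where
  "stop a b w = (if a \<le> b then shift T t L \<omega> a w else shift T t U \<omega> b w)"

lemma payoff_eq: "payoff T g L U t \<omega> \<tau> \<gamma> w = run (min (\<tau> w) (\<gamma> w)) w + stop (\<tau> w) (\<gamma> w) w"
  by (simp add: payoff_def run_def stop_def)

lemma run_diff_le:
  assumes w: "w \<in> Om T t" and ab: "t \<le> a" "a \<le> b" "b \<le> T"
  shows "\<bar>run b w - run a w\<bar> \<le> (b - a) * (\<bar>g t \<omega>\<bar> + Y w)"
proof -
  let ?f = "\<lambda>s. shift T t g \<omega> s w"
  have cont: "continuous_on {t..T} ?f" by (rule shift_continuous[OF reg_g \<rho>1 \<omega> w t(1) t_le_T])
  \<comment> \<open>Passing to the Henstock-Kurzweil integral lets adjacent intervals be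
    combined.\<close>
  have run: "run c w = integral {t..c} ?f" if "c \<le> T" for c
    unfolding run_def
    by (intro set_borel_integral_eq_integral borel_integrable_atLeastAtMost' continuous_on_subset[OF cont])
       (use that in auto)
  have "integral {t..a} ?f + integral {a..b} ?f = integral {t..b} ?f"
    using ab by (intro Henstock_Kurzweil_Integration.integral_combine integrable_continuous_interval
        continuous_on_subset[OF cont]) auto
  then have "run b w - run a w = integral {a..b} ?f" using run[of a] run[of b] ab by simp
  also have "\<bar>\<dots>\<bar> \<le> (\<bar>g t \<omega>\<bar> + Y w) * (b - a)"
    using ab shift_bound[OF reg_g w]
    by (intro integral_bound[where 'a = real, unfolded real_norm_def] continuous_on_subset[OF cont]) auto
  finally show ?thesis by (simp add: mult.commute)
qed

lemma run_start: "run t w = 0"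
proof -
  have "set_integrable lborel {t..t} (\<lambda>s. shift T t g \<omega> s w)"
    by (rule borel_integrable_atLeastAtMost') simp
  from set_borel_integral_eq_integral(2)[OF this] show ?thesis by (simp add: run_def)
qed

lemma run_le:
  assumes w: "w \<in> Om T t" and a: "t \<le> a" "a \<le> T"
  shows "\<bar>run a w\<bar> \<le> T * (\<bar>g t \<omega>\<bar> + Y w)"
proof -
  have "\<bar>run a w\<bar> \<le> (a - t) * (\<bar>g t \<omega>\<bar> + Y w)"
    using run_diff_le[OF w order_refl a] by (simp add: run_start)
  also have "\<dots> \<le> T * (\<bar>g t \<omega>\<bar> + Y w)"
    using a t Y_nonneg[OF w] by (intro mult_right_mono) auto
  finally show ?thesis .
qed

lemma stop_le:
  assumes w: "w \<in> Om T t" and a: "t \<le> a" "a \<le> T" and b: "t \<le> b" "b \<le> T"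
  shows "\<bar>stop a b w\<bar> \<le> \<bar>L t \<omega>\<bar> + \<bar>U t \<omega>\<bar> + Y w"
proof (cases "a \<le> b")
  case True
  then show ?thesis using shift_bound[OF reg_L w a] unfolding stop_def by simp
next
  case False
  then show ?thesis using shift_bound[OF reg_U w b] unfolding stop_def by simp
qed

text \<open>Postponing the first player's stopping from \<open>a\<close> to \<open>a'\<close> changes the terminal payoff only if
  \<open>a \<le> b\<close>, and if the second player stops in between, he pays \<open>U \<ge> L\<close>.\<close>

lemma stop_diff_le:
  assumes w: "w \<in> Om T t" and a: "t \<le> a" "a \<le> a'" "a' \<le> T" "a' \<le> a + \<delta>" and b: "t \<le> b" "b \<le> T"
  shows "stop a b w - stop a' b w \<le> \<rho>1 (\<delta> + path_osc T \<delta> a w)"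
proof -
  \<comment> \<open>Applied with \<open>c = a'\<close> if the second player does not stop before
    \<open>a'\<close>, and with \<open>c = b\<close> if he stops in between.\<close>
  have osc: "shift T t L \<omega> a w - shift T t L \<omega> c w \<le> \<rho>1 (\<delta> + path_osc T \<delta> a w)"
    if "a \<le> c" "c \<le> a'" for c
    using shift_osc_le[OF reg_L \<rho>1 \<omega> w t(1) a(1) that(1), of \<delta>] that a by linarith
  have LU: "shift T t L \<omega> b w \<le> shift T t U \<omega> b w"
    unfolding shift_def using L_le_U concat_at_Om[OF \<omega> w t(1) t_le_T] b t by auto
  \<comment> \<open>Settles the case \<open>b < a\<close>, where both terminal payoffs are
    \<open>U\<close> at \<open>b\<close>.\<close>
  have "0 \<le> \<rho>1 (\<delta> + path_osc T \<delta> a w)"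
    using path_osc_nonneg[OF w a(1), of \<delta>] a by (intro modulus_nonneg[OF \<rho>1]) auto
  then show ?thesis
    using osc[of a'] osc[of b] LU a(2) by (auto simp: stop_def)
qed

lemma run_measurable:
  assumes "\<tau> \<in> ST T t" "\<gamma> \<in> ST T t"
  shows "(\<lambda>w. run (min (\<tau> w) (\<gamma> w)) w) \<in> borel_measurable (Fil T t T)"
  unfolding run_def
  using ST_measurable[OF assms(1)] ST_measurable[OF assms(2)] ST_range[OF assms(1)] ST_range[OF assms(2)]
  by (intro shift_integral_measurable[OF reg_g \<rho>1 \<omega> t]) (auto simp: min_def)

lemma stop_measurable:
  assumes "\<tau> \<in> ST T t" "\<gamma> \<in> ST T t"
  shows "(\<lambda>w. stop (\<tau> w) (\<gamma> w) w) \<in> borel_measurable (Fil T t T)"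
proof -
  note [measurable] = ST_measurable[OF assms(1)] ST_measurable[OF assms(2)]
  have [measurable]: "(\<lambda>w. shift T t L \<omega> (\<tau> w) w) \<in> borel_measurable (Fil T t T)"
    "(\<lambda>w. shift T t U \<omega> (\<gamma> w) w) \<in> borel_measurable (Fil T t T)"
    using ST_range[OF assms(1)] ST_range[OF assms(2)]
    by (auto intro!: shift_at_measurable[OF _ \<rho>1 \<omega> t] reg_L reg_U)
  show ?thesis unfolding stop_def by measurable
qed

section \<open>Expected payoffs under a fixed probability\<close>

context
  fixes P :: "'d path measure" and b :: real
  assumes P: "P \<in> Probs T t" and Y: "(\<integral>\<^sup>+w. ennreal (Y w) \<partial>P) \<le> ennreal b" and b: "0 \<le> b"
begin

lemma P_prob: "prob_space P" and P_space: "space P = Om T t"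
  and P_measurable: "borel_measurable P = borel_measurable (Fil T t T)"
proof -
  show "prob_space P" using P by (simp add: Probs_def)
  have sets: "sets P = sets (Fil T t T)" using P by (simp add: Probs_def)
  show "space P = Om T t" using sets_eq_imp_space_eq[OF sets] by simp
  show "borel_measurable P = borel_measurable (Fil T t T)" by (rule measurable_cong_sets[OF sets refl])
qed

lemma Y_finite: "(\<integral>\<^sup>+w. ennreal (Y w) \<partial>P) < \<infinity>"
  using Y by (rule order.strict_trans1) simp

lemma run_integrable:
  assumes \<tau>: "\<tau> \<in> ST T t" and \<gamma>: "\<gamma> \<in> ST T t"
  shows "integrable P (\<lambda>w. run (min (\<tau> w) (\<gamma> w)) w)"
proof (rule integrable_dominated[OF P_prob _ _ _ Y_finite])
  show "\<bar>run (min (\<tau> w) (\<gamma> w)) w\<bar> \<le> T * \<bar>g t \<omega>\<bar> + T * Y w" if "w \<in> space P" for w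
  proof -
    have w: "w \<in> Om T t" using that by (simp add: P_space)
    show ?thesis
      unfolding distrib_left[symmetric] using ST_range[OF \<tau> w] ST_range[OF \<gamma> w]
      by (intro run_le[OF w]) auto
  qed
qed (use run_measurable[OF \<tau> \<gamma>] P_measurable t in auto)

lemma stop_integrable:
  assumes \<tau>: "\<tau> \<in> ST T t" and \<gamma>: "\<gamma> \<in> ST T t"
  shows "integrable P (\<lambda>w. stop (\<tau> w) (\<gamma> w) w)"
proof (rule integrable_dominated[OF P_prob _ _ _ Y_finite])
  show "\<bar>stop (\<tau> w) (\<gamma> w) w\<bar> \<le> \<bar>L t \<omega>\<bar> + \<bar>U t \<omega>\<bar> + 1 * Y w" if "w \<in> space P" for w
    using that stop_le[of w "\<tau> w" "\<gamma> w"] ST_range[OF \<tau>] ST_range[OF \<gamma>] by (auto simp: P_space)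
qed (use stop_measurable[OF \<tau> \<gamma>] P_measurable in auto)

lemma expectation_payoff:
  assumes \<tau>: "\<tau> \<in> ST T t" and \<gamma>: "\<gamma> \<in> ST T t"
  shows "(\<integral>w. payoff T g L U t \<omega> \<tau> \<gamma> w \<partial>P)
    = (\<integral>w. run (min (\<tau> w) (\<gamma> w)) w \<partial>P) + (\<integral>w. stop (\<tau> w) (\<gamma> w) w \<partial>P)"
  unfolding payoff_eq using assms by (intro Bochner_Integration.integral_add run_integrable stop_integrable)

text \<open>Uniform in both stopping times, and in \<open>P\<close> as long as \<open>b\<close> is.
  This makes the suprema and infima in \<open>V\<close> finite. In the factor \<open>T + 1\<close>
  of \<open>b\<close>, \<open>T\<close> comes from the running payoff and 1 from the terminal
  one.\<close>

lemma expectation_payoff_bound: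
  assumes \<tau>: "\<tau> \<in> ST T t" and \<gamma>: "\<gamma> \<in> ST T t"
  shows "\<bar>\<integral>w. payoff T g L U t \<omega> \<tau> \<gamma> w \<partial>P\<bar> \<le> T * \<bar>g t \<omega>\<bar> + \<bar>L t \<omega>\<bar> + \<bar>U t \<omega>\<bar> + (T + 1) * b"
proof -
  let ?c = "T * \<bar>g t \<omega>\<bar> + \<bar>L t \<omega>\<bar> + \<bar>U t \<omega>\<bar>"
  let ?f = "\<lambda>w. \<bar>payoff T g L U t \<omega> \<tau> \<gamma> w\<bar>"
  have "(\<integral>w. ?f w \<partial>P) \<le> ?c + (T + 1) * b"
  proof (rule integral_le_dominated[OF P_prob _ _ _ Y b])
    show "integrable P ?f"
      unfolding payoff_eq using assms
      by (intro integrable_abs Bochner_Integration.integrable_add run_integrable stop_integrable)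
    fix w assume "w \<in> space P"
    then have w: "w \<in> Om T t" by (simp add: P_space)
    have "?f w \<le> \<bar>run (min (\<tau> w) (\<gamma> w)) w\<bar> + \<bar>stop (\<tau> w) (\<gamma> w) w\<bar>" by (simp add: payoff_eq)
    also have "\<dots> \<le> T * (\<bar>g t \<omega>\<bar> + Y w) + (\<bar>L t \<omega>\<bar> + \<bar>U t \<omega>\<bar> + Y w)"
      using ST_range[OF \<tau> w] ST_range[OF \<gamma> w] by (intro add_mono run_le[OF w] stop_le[OF w]) auto
    finally show "?f w \<le> ?c + (T + 1) * Y w" by (simp add: algebra_simps)
  qed (use t in simp)
  then show ?thesis using integral_abs_bound[of P "payoff T g L U t \<omega> \<tau> \<gamma>"] by linarith
qed

text \<open>The running part is controlled by the oscillation from \<open>t\<close>, the terminal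
  part by the oscillation from \<tau>. They are integrated separately: without measurability of the
  dominating functions, bounds on their two \<open>nn_integral\<close> values need not bound that of
  the sum.\<close>

lemma expectation_payoff_postpone:
  assumes \<tau>: "\<tau> \<in> ST T t" and \<tau>': "\<tau>' \<in> ST T t" and \<gamma>: "\<gamma> \<in> ST T t"
    and h: "0 < h" "\<And>w. w \<in> Om T t \<Longrightarrow> \<tau> w \<le> \<tau>' w \<and> \<tau>' w \<le> \<tau> w + h"
    and a: "0 \<le> a" "(\<integral>\<^sup>+w. ennreal (\<rho>1 (h + path_osc T h (\<tau> w) w)) \<partial>P) \<le> ennreal a"
  shows "(\<integral>w. payoff T g L U t \<omega> \<tau> \<gamma> w \<partial>P)
    \<le> (\<integral>w. payoff T g L U t \<omega> \<tau>' \<gamma> w \<partial>P) + a + h * (\<bar>g t \<omega>\<bar> + b)"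
proof -
  let ?A = "\<lambda>w. run (min (\<tau> w) (\<gamma> w)) w - run (min (\<tau>' w) (\<gamma> w)) w"
  let ?B = "\<lambda>w. stop (\<tau> w) (\<gamma> w) w - stop (\<tau>' w) (\<gamma> w) w"
  note int = run_integrable[OF \<tau> \<gamma>] run_integrable[OF \<tau>' \<gamma>] stop_integrable[OF \<tau> \<gamma>] stop_integrable[OF \<tau>' \<gamma>]
  have "(\<integral>w. ?A w \<partial>P) \<le> h * \<bar>g t \<omega>\<bar> + h * b"
  proof (rule integral_le_dominated[OF P_prob _ _ h(1) Y b])
    fix w assume "w \<in> space P"
    then have w: "w \<in> Om T t" by (simp add: P_space)
    note r = ST_range[OF \<tau> w] ST_range[OF \<tau>' w] ST_range[OF \<gamma> w] h(2)[OF w]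
    have "\<bar>run (min (\<tau>' w) (\<gamma> w)) w - run (min (\<tau> w) (\<gamma> w)) w\<bar>
        \<le> (min (\<tau>' w) (\<gamma> w) - min (\<tau> w) (\<gamma> w)) * (\<bar>g t \<omega>\<bar> + Y w)"
      using r by (intro run_diff_le[OF w]) auto
    \<comment> \<open>Cutting both times off at \<gamma> does not increase their distance, which is
      at most \<open>h\<close>.\<close>
    also have "\<dots> \<le> h * (\<bar>g t \<omega>\<bar> + Y w)"
      using r Y_nonneg[OF w] h(1) by (intro mult_right_mono) auto
    finally show "?A w \<le> h * \<bar>g t \<omega>\<bar> + h * Y w" by (simp add: distrib_left)
  qed (use int in auto)
  moreover have "(\<integral>w. ?B w \<partial>P) \<le> 0 + 1 * a"
  proof (rule integral_le_dominated[OF P_prob _ _ _ a(2,1)])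
    fix w assume "w \<in> space P"
    then have w: "w \<in> Om T t" by (simp add: P_space)
    show "?B w \<le> 0 + 1 * \<rho>1 (h + path_osc T h (\<tau> w) w)"
      using stop_diff_le[OF w, of "\<tau> w" "\<tau>' w" h "\<gamma> w"] ST_range[OF \<tau> w] ST_range[OF \<tau>' w] ST_range[OF \<gamma> w] h(2)[OF w]
      by simp
  qed (use int in auto)
  ultimately show ?thesis
    using int by (simp add: expectation_payoff[OF \<tau> \<gamma>] expectation_payoff[OF \<tau>' \<gamma>] distrib_left)
qed

end

end

section \<open>From expected payoffs to values\<close>

text \<open>The suprema are taken in \<open>ennreal\<close>, a complete lattice, so each member lies
  below them without any boundedness condition.\<close>

lemma uniform_oscillationD:
  assumes "uniform_oscillation T \<P> \<rho>1 \<rho>" "0 < \<alpha>" "t \<in> {0..<T}" "\<delta> \<in> {0<..T}"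
    and "\<omega> \<in> pball T 0 t \<alpha> (null_path T)" "P \<in> \<P> t \<omega>" "\<zeta> \<in> ST T t"
  shows "(\<integral>\<^sup>+w. ennreal (\<rho>1 (\<delta> + path_osc T \<delta> (\<zeta> w) w)) \<partial>P) \<le> ennreal (\<rho> \<alpha> \<delta>)"
proof -
  have "(\<integral>\<^sup>+w. ennreal (\<rho>1 (\<delta> + path_osc T \<delta> (\<zeta> w) w)) \<partial>P)
     \<le> (SUP \<omega>\<in>pball T 0 t \<alpha> (null_path T). SUP P\<in>\<P> t \<omega>. SUP \<zeta>\<in>ST T t.
         \<integral>\<^sup>+w. ennreal (\<rho>1 (\<delta> + path_osc T \<delta> (\<zeta> w) w)) \<partial>P)"
    by (rule SUP_upper2[OF assms(5)], rule SUP_upper2[OF assms(6)], rule SUP_upper2[OF assms(7)], simp)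
  also have "\<dots> \<le> ennreal (\<rho> \<alpha> \<delta>)"
    unfolding path_osc_def using assms(1-4) by (simp add: uniform_oscillation_def)
  finally show ?thesis .
qed

text \<open>The bound \<open>M\<close> keeps the real-valued suprema and infima away from their junk values.\<close>

lemma INF_INF_SUP_le_add:
  fixes f :: "'a \<Rightarrow> 'b \<Rightarrow> 'c \<Rightarrow> real"
  assumes ne: "A \<noteq> {}" "B \<noteq> {}" "S \<noteq> {}" and sub: "S' \<subseteq> S"
    and bound: "\<And>x y z. x \<in> A \<Longrightarrow> y \<in> B \<Longrightarrow> z \<in> S \<Longrightarrow> \<bar>f x y z\<bar> \<le> M"
    and approx: "\<And>x y z. x \<in> A \<Longrightarrow> y \<in> B \<Longrightarrow> z \<in> S \<Longrightarrow> \<exists>z'\<in>S'. f x y z \<le> f x y z' + c"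
  shows "(INF x\<in>A. INF y\<in>B. SUP z\<in>S. f x y z) \<le> (INF x\<in>A. INF y\<in>B. SUP z\<in>S'. f x y z) + c"
proof -
  have bdd: "bdd_above (f x y ` S)" if "x \<in> A" "y \<in> B" for x y
    using bound[OF that] by (intro bdd_aboveI2[where M = M]) (auto simp: abs_le_iff)
  obtain z0 where z0: "z0 \<in> S" using ne(3) by blast
  \<comment> \<open>One point \<open>z0\<close> bounds every supremum from below, which makes both
    infima bounded below.\<close>
  have lower: "- M \<le> (SUP z\<in>S. f x y z)" if "x \<in> A" "y \<in> B" for x y
    using bound[OF that z0] by (intro cSUP_upper2[OF bdd[OF that] z0]) (auto simp: abs_le_iff)
  have lower': "- M \<le> (INF y\<in>B. SUP z\<in>S. f x y z)" if "x \<in> A" for x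
    using lower that ne(2) by (intro cINF_greatest) auto
  have "(INF x\<in>A. INF y\<in>B. SUP z\<in>S. f x y z) - c \<le> (SUP z\<in>S'. f x y z)" if xy: "x \<in> A" "y \<in> B" for x y
  proof -
    have "(INF x\<in>A. INF y\<in>B. SUP z\<in>S. f x y z) \<le> (INF y\<in>B. SUP z\<in>S. f x y z)"
      by (rule cINF_lower[OF bdd_belowI2 xy(1)]) (rule lower')
    also have "\<dots> \<le> (SUP z\<in>S. f x y z)"
      by (rule cINF_lower[OF bdd_belowI2 xy(2)]) (rule lower[OF xy(1)])
    also have "\<dots> \<le> (SUP z\<in>S'. f x y z) + c"
    proof (rule cSUP_least[OF ne(3)])
      fix z assume "z \<in> S"
      from approx[OF xy this] obtain z' where z': "z' \<in> S'" "f x y z \<le> f x y z' + c" by blast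
      have "f x y z' \<le> (SUP z\<in>S'. f x y z)"
        using bdd_above_mono[OF bdd[OF xy] image_mono[OF sub]] by (intro cSUP_upper z'(1))
      then show "f x y z \<le> (SUP z\<in>S'. f x y z) + c" using z'(2) by simp
    qed
    finally show ?thesis by simp
  qed
  then have "(INF x\<in>A. INF y\<in>B. SUP z\<in>S. f x y z) - c \<le> (INF x\<in>A. INF y\<in>B. SUP z\<in>S'. f x y z)"
    using ne by (intro cINF_greatest) auto
  then show ?thesis by simp
qed

text \<open>At the horizon every stopping time equals \<open>T\<close>, which is a grid point. This
  settles the case that the oscillation bound leaves out.\<close>

lemma STn_at_horizon: "STn T T n = (ST T T :: (('d::finite) path \<Rightarrow> real) set)" (is "?STn = ?ST")
proof
  show "?ST \<subseteq> ?STn"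
  proof (cases n)
    case (enat k)
    show ?thesis
    proof
      fix \<tau> :: "'d path \<Rightarrow> real" assume \<tau>: "\<tau> \<in> ST T T"
      \<comment> \<open>The last index \<open>2^k\<close> gives the grid value \<open>T\<close>
        whatever the sign of \<open>T\<close>, which is unrestricted here.\<close>
      have "\<exists>i. \<tau> w = max T (real i * (1/2)^k * T) \<and> i \<le> 2^k" if "w \<in> Om T T" for w
        using ST_range[OF \<tau> that] by (intro exI[of _ "2^k"]) (simp add: power_divide)
      then show "\<tau> \<in> STn T T n" using \<tau> enat by (simp add: STn_def)
    qed
  qed (simp add: STn_def)
qed (rule STn_subset_ST)

theorem proposition3p3:
  fixes T :: real
    and g L U :: "real \<Rightarrow> ('d::finite) path \<Rightarrow> real"
    and \<P> :: "real \<Rightarrow> 'd path \<Rightarrow> 'd path measure set"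
    and \<rho>0 \<rho>h \<rho>1 :: "real \<Rightarrow> real"
    and \<rho> :: "real \<Rightarrow> real \<Rightarrow> real"
    and n :: nat and t \<alpha> :: real and \<omega> :: "'d path"
  assumes "0 < T"
    and "payoff_regular T g L U \<rho>0"
    and "integrability T g L U"
    and "adapted_class T g L U \<P>"
    and "stable_conditioning T \<P>"
    and "weakly_stable_pasting T g L U \<P> \<rho>h"
    and "values_path_continuous T g L U \<P> \<rho>0 \<rho>1"
    and "uniform_oscillation T \<P> \<rho>1 \<rho>"
    and "1 \<le> n" and "t \<in> {0..T}" and "0 < \<alpha>"
    and "\<omega> \<in> pball T 0 t \<alpha> (null_path T)"
  shows "V T g L U \<P> \<infinity> t \<omega>
         \<le> V T g L U \<P> (enat n) t \<omega> + \<rho> \<alpha> ((1/2)^n * T)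
           + (1/2)^n * T * (\<bar>g t \<omega>\<bar> + \<rho> \<alpha> (T - t))"
proof -
  define h where "h = (1/2)^n * T"
  have h: "0 < h" "h \<le> T"
    using assms(1) by (auto simp: h_def power_le_one mult_left_le_one_le)
  have \<rho>\<alpha>: "modulus (\<rho> \<alpha>)" using assms(8,11) by (simp add: uniform_oscillation_def)
  have nonneg: "0 \<le> \<rho> \<alpha> h" "0 \<le> \<rho> \<alpha> (T - t)"
    using modulus_nonneg[OF \<rho>\<alpha>] h assms(10) by auto
  show ?thesis
  \<comment> \<open>At the horizon the two values agree, and nonnegativity of the error terms is
    enough.\<close>
  proof (cases "t = T")
    case True
    then have "V T g L U \<P> \<infinity> t \<omega> = V T g L U \<P> (enat n) t \<omega>" by (simp add: V_def STn_at_horizon)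
    then show ?thesis using nonneg h unfolding h_def[symmetric] by simp
  next
    case False
    then have t: "0 \<le> t" "t < T" using assms(10) by auto
    have \<omega>: "\<omega> \<in> Om T 0" using assms(12) by (simp add: pball_def)
    have \<rho>1: "modulus \<rho>1" "\<And>x. 0 \<le> x \<Longrightarrow> \<rho>0 x \<le> \<rho>1 x"
      using assms(7) by (auto simp: values_path_continuous_def)
    have reg: "path_regular T X \<rho>1" if "X \<in> {g, L, U}" for X
    proof (rule path_regular_weaken[of _ _ \<rho>0])
      show "path_regular T X \<rho>0" using assms(2) that unfolding payoff_regular_def path_regular_def by blast
    qed (use assms(1) \<rho>1 in auto)
    have LU: "L s \<omega>' \<le> U s \<omega>'" if "s \<in> {0..T}" "\<omega>' \<in> Om T 0" for s \<omega>'
      using assms(2) that unfolding payoff_regular_def by blast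
    interpret game_position T t g L U \<rho>1 \<omega>
      unfolding game_position_def using LU by (simp add: reg \<rho>1(1) \<omega> t)
    have \<P>: "\<P> t \<omega> \<noteq> {}" "\<P> t \<omega> \<subseteq> Probs T t"
    proof -
      have "\<P> t \<omega> \<noteq> {} \<and> \<P> t \<omega> \<subseteq> Phat T g L U t"
        using assms(4,10) \<omega> unfolding adapted_class_def by blast
      moreover have "Phat T g L U t \<subseteq> Probs T t" unfolding Phat_def by blast
      ultimately show "\<P> t \<omega> \<noteq> {}" "\<P> t \<omega> \<subseteq> Probs T t" by blast+
    qed
    \<comment> \<open>Used twice: at the constant time \<open>t\<close> with \<delta> =
      \<open>T - t\<close>, to bound \<open>Y\<close>, and at \<tau> with \<delta> =
      \<open>h\<close>, for the terminal payoff.\<close>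
    note osc = uniform_oscillationD[OF assms(8,11) _ _ assms(12)]
    have Y: "(\<integral>\<^sup>+w. ennreal (Y w) \<partial>P) \<le> ennreal (\<rho> \<alpha> (T - t))" if "P \<in> \<P> t \<omega>" for P
      unfolding Y_def using t by (intro osc[OF _ _ that const_ST]) auto
    have "V T g L U \<P> \<infinity> t \<omega> \<le> V T g L U \<P> (enat n) t \<omega> + (\<rho> \<alpha> h + h * (\<bar>g t \<omega>\<bar> + \<rho> \<alpha> (T - t)))"
      unfolding V_def
    proof (rule INF_INF_SUP_le_add[OF \<P>(1)])
      have STn_inf: "STn T t \<infinity> = (ST T t :: ('d path \<Rightarrow> real) set)" by (simp add: STn_def)
      have "(\<lambda>_. T) \<in> (ST T t :: ('d path \<Rightarrow> real) set)" using const_ST[of t T T] t by simp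
      then show "(ST T t :: ('d path \<Rightarrow> real) set) \<noteq> {}" "(STn T t \<infinity> :: ('d path \<Rightarrow> real) set) \<noteq> {}"
        unfolding STn_inf by blast+
      show "(STn T t (enat n) :: ('d path \<Rightarrow> real) set) \<subseteq> STn T t \<infinity>"
        unfolding STn_inf by (rule STn_subset_ST)
      fix P and \<gamma> \<tau> :: "'d path \<Rightarrow> real"
      assume P: "P \<in> \<P> t \<omega>" and \<gamma>: "\<gamma> \<in> ST T t" and "\<tau> \<in> STn T t \<infinity>"
      then have \<tau>: "\<tau> \<in> ST T t" by (simp add: STn_inf)
      have P': "P \<in> Probs T t" using P \<P> by blast
      \<comment> \<open>This is the bound \<open>M\<close>; it does not depend on \<open>P\<close>,
        since the oscillation bound is uniform over \<open>\<P> t \<omega>\<close>.\<close>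
      show "\<bar>\<integral>w. payoff T g L U t \<omega> \<tau> \<gamma> w \<partial>P\<bar>
          \<le> T * \<bar>g t \<omega>\<bar> + \<bar>L t \<omega>\<bar> + \<bar>U t \<omega>\<bar> + (T + 1) * \<rho> \<alpha> (T - t)"
        by (rule expectation_payoff_bound[OF P' Y[OF P] nonneg(2) \<tau> \<gamma>])
      show "\<exists>\<tau>'\<in>STn T t (enat n). (\<integral>w. payoff T g L U t \<omega> \<tau> \<gamma> w \<partial>P)
          \<le> (\<integral>w. payoff T g L U t \<omega> \<tau>' \<gamma> w \<partial>P) + (\<rho> \<alpha> h + h * (\<bar>g t \<omega>\<bar> + \<rho> \<alpha> (T - t)))"
      proof
        show \<tau>': "grid_ceiling h \<tau> \<in> STn T t (enat n)"
          unfolding h_def by (rule grid_ceiling_STn[OF assms(1) t(1) \<tau>])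
        have "(\<integral>\<^sup>+w. ennreal (\<rho>1 (h + path_osc T h (\<tau> w) w)) \<partial>P) \<le> ennreal (\<rho> \<alpha> h)"
          using t h by (intro osc[OF _ _ P \<tau>]) auto
        moreover have "\<tau> w \<le> grid_ceiling h \<tau> w \<and> grid_ceiling h \<tau> w \<le> \<tau> w + h" for w
          by (intro conjI grid_ceiling_ge grid_ceiling_le h(1))
        ultimately have "(\<integral>w. payoff T g L U t \<omega> \<tau> \<gamma> w \<partial>P)
            \<le> (\<integral>w. payoff T g L U t \<omega> (grid_ceiling h \<tau>) \<gamma> w \<partial>P) + \<rho> \<alpha> h + h * (\<bar>g t \<omega>\<bar> + \<rho> \<alpha> (T - t))"
          by (intro expectation_payoff_postpone[OF P' Y[OF P] nonneg(2) \<tau> set_mp[OF STn_subset_ST \<tau>'] \<gamma> h(1) _ nonneg(1)]) blast+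
        then show "(\<integral>w. payoff T g L U t \<omega> \<tau> \<gamma> w \<partial>P)
          \<le> (\<integral>w. payoff T g L U t \<omega> (grid_ceiling h \<tau>) \<gamma> w \<partial>P) + (\<rho> \<alpha> h + h * (\<bar>g t \<omega>\<bar> + \<rho> \<alpha> (T - t)))"
          by (simp add: add.assoc)
      qed
    qed
    then show ?thesis unfolding h_def by simp
  qed
qed

end
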